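(* Let $\Omega\subset\mathbb{C}^n$ be a bounded pseudoconvex Reinhardt domain, $1<p<\infty$, $q=p/(p-1)$, and $\lambda$ an admissible multi-radial weight on $\Omega$. If the Monomial Basis Projection $\bm{P}^{\Omega}_{p,\lambda}:L^p(\Omega,\lambda)\to A^p(\Omega,\lambda)$ exists, then for every $f\in L^p(\Omega,\lambda)$ and $z\in\Omega$, $$\bm{P}^{\Omega}_{p,\lambda}(f)(z)=\int_\Omega K^{\Omega}_{p,\lambda}(z,w)f(w)\lambda(w)\,dV(w),$$ and for each $z\in\Omega$ we have $K^{\Omega}_{p,\lambda}(z,\cdot)\in L^q(\Omega,\lambda)$.
   Context: A domain $\Omega$ is Reinhardt (centered at $0$) if $(e^{i\theta_1}z_1,\dots,e^{i\theta_n}z_n)\in\Omega$ whenever $z\in\Omega$, $\theta\in\mathbb{R}^n$. For a measurable $\lambda:\Omega\to[0,\infty]$, positive a.e., $\|f\|_{p,\lambda}^p=\int_\Omega|f|^p\lambda\,dV$ ($dV$ Lebesgue measure), $L^p(\Omega,\lambda)$ is the corresponding space and $A^p(\Omega,\lambda)=L^p(\Omega,\lambda)\cap\mathcal{O}(\Omega)$. $\lambda$ is admissible if for each compact $K\subset\Omega$ there is $C_K$ with $\sup_K|f|\le C_K\|f\|_{p,\lambda}$ for all $f\in A^p(\Omega,\lambda)$; multi-radial if $\lambda(z)$ depends only on $(|z_1|,\dots,|z_n|)$. $e_\alpha(z)=z_1^{\alpha_1}\cdots z_n^{\alpha_n}$ for $\alpha\in\mathbb{Z}^n$, $|\alpha|_\infty=\max_j|\alpha_j|$,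 $\mathcal{S}_p(\Omega,\lambda)=\{\alpha:e_\alpha\in A^p(\Omega,\lambda)\}$. Monomial Basis Kernel: $K^{\Omega}_{p,\lambda}(z,w)=\sum_{\alpha\in\mathcal{S}_p(\Omega,\lambda)}e_\alpha(z)\overline{e_\alpha(w)}|e_\alpha(w)|^{p-2}/\|e_\alpha\|_{p,\lambda}^p$. Each $f\in\mathcal{O}(\Omega)$ has a unique locally normally convergent Laurent expansion $f=\sum_\alpha c_\alpha e_\alpha$; set $a_\alpha(f)=c_\alpha$. Restricted to $A^p(\Omega,\lambda)$, $a_\alpha$ is bounded, and $\widetilde{a}_\alpha$ denotes its unique norm-preserving extension to $L^p(\Omega,\lambda)$. The Monomial Basis Projection of $A^p(\Omega,\lambda)$ (if it exists) is a bounded linear projection $\bm{P}^\Omega_{p,\lambda}$ from $L^p(\Omega,\lambda)$ onto $A^p(\Omega,\lambda)$ such that for every $f\in L^p(\Omega,\lambda)$, $\bm{P}^\Omega_{p,\lambda}f=\lim_{N\to\infty}\sum_{\alpha\in\mathcal{S}_p(\Omega,\lambda),|\alpha|_\infty\le N}\widetilde{a}_\alpha(f)e_\alpha$ in the norm of $L^p(\Omega,\lambda)$. *)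

theory Defs
  imports "HOL-Analysis.Analysis"
begin

definition cdomain :: "(complex^'n) set \<Rightarrow> bool" where
  "cdomain \<Omega> \<longleftrightarrow> open \<Omega> \<and> connected \<Omega> \<and> \<Omega> \<noteq> {}"

definition reinhardt :: "(complex^'n) set \<Rightarrow> bool" where
  "reinhardt \<Omega> \<longleftrightarrow>
     (\<forall>z\<in>\<Omega>. \<forall>\<theta>::'n \<Rightarrow> real. (\<chi> j. exp (\<i> * of_real (\<theta> j)) * z$j) \<in> \<Omega>)"

definition cont_psh :: "(complex^'n) set \<Rightarrow> (complex^'n \<Rightarrow> real) \<Rightarrow> bool" where
  "cont_psh \<Omega> u \<longleftrightarrow> continuous_on \<Omega> u \<and>
     (\<forall>a b. (\<forall>\<zeta>::complex. norm \<zeta> \<le> 1 \<longrightarrow> a + \<zeta> *s b \<in> \<Omega>) \<longrightarrow>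
        u a \<le> (1 / (2*pi)) * integral {0..2*pi} (\<lambda>t. u (a + exp (\<i> * of_real t) *s b)))"

definition pseudoconvex :: "(complex^'n) set \<Rightarrow> bool" where
  "pseudoconvex \<Omega> \<longleftrightarrow> (\<exists>\<phi>. cont_psh \<Omega> \<phi> \<and>
     (\<forall>c::real. compact (closure {z\<in>\<Omega>. \<phi> z < c}) \<and> closure {z\<in>\<Omega>. \<phi> z < c} \<subseteq> \<Omega>))"

definition holo_n :: "(complex^'n) set \<Rightarrow> (complex^'n \<Rightarrow> complex) \<Rightarrow> bool" where
  "holo_n \<Omega> f \<longleftrightarrow> (\<forall>z\<in>\<Omega>. \<exists>L. (f has_derivative L) (at z) \<and> (\<forall>c v. L (c *s v) = c * L v))"

definition wmeasure :: "(complex^'n) set \<Rightarrow> (complex^'n \<Rightarrow> ennreal) \<Rightarrow> (complex^'n) measure" where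
  "wmeasure \<Omega> wt = density lebesgue (\<lambda>z. wt z * indicator \<Omega> z)"

definition Lp_space :: "(complex^'n) set \<Rightarrow> (complex^'n \<Rightarrow> ennreal) \<Rightarrow> real \<Rightarrow> (complex^'n \<Rightarrow> complex) set" where
  "Lp_space \<Omega> wt p = {f. f \<in> borel_measurable (wmeasure \<Omega> wt) \<and>
      (\<integral>\<^sup>+ z. ennreal (norm (f z) powr p) \<partial>wmeasure \<Omega> wt) < \<infinity>}"

definition Lpnorm :: "(complex^'n) set \<Rightarrow> (complex^'n \<Rightarrow> ennreal) \<Rightarrow> real \<Rightarrow> (complex^'n \<Rightarrow> complex) \<Rightarrow> real" where
  "Lpnorm \<Omega> wt p f = enn2real (\<integral>\<^sup>+ z. ennreal (norm (f z) powr p) \<partial>wmeasure \<Omega> wt) powr (1/p)"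

definition Ap_space :: "(complex^'n) set \<Rightarrow> (complex^'n \<Rightarrow> ennreal) \<Rightarrow> real \<Rightarrow> (complex^'n \<Rightarrow> complex) set" where
  "Ap_space \<Omega> wt p = {f \<in> Lp_space \<Omega> wt p. holo_n \<Omega> f}"

definition admissible :: "(complex^'n) set \<Rightarrow> (complex^'n \<Rightarrow> ennreal) \<Rightarrow> real \<Rightarrow> bool" where
  "admissible \<Omega> wt p \<longleftrightarrow> (\<forall>K. compact K \<and> K \<subseteq> \<Omega> \<longrightarrow>
     (\<exists>C. \<forall>f\<in>Ap_space \<Omega> wt p. \<forall>z\<in>K. norm (f z) \<le> C * Lpnorm \<Omega> wt p f))"

definition multi_radial :: "(complex^'n) set \<Rightarrow> (complex^'n \<Rightarrow> ennreal) \<Rightarrow> bool" where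
  "multi_radial \<Omega> wt \<longleftrightarrow>
     (\<forall>z\<in>\<Omega>. \<forall>w\<in>\<Omega>. (\<forall>j. norm (z$j) = norm (w$j)) \<longrightarrow> wt z = wt w)"

definition monom :: "('n::finite \<Rightarrow> int) \<Rightarrow> complex^'n \<Rightarrow> complex" where
  "monom \<alpha> z = (\<Prod>j\<in>UNIV. (z$j) powi (\<alpha> j))"

definition supnorm :: "('n::finite \<Rightarrow> int) \<Rightarrow> int" where
  "supnorm \<alpha> = Max (range (\<lambda>j. \<bar>\<alpha> j\<bar>))"

definition Sp_set :: "(complex^'n::finite) set \<Rightarrow> (complex^'n \<Rightarrow> ennreal) \<Rightarrow> real \<Rightarrow> ('n \<Rightarrow> int) set" where
  "Sp_set \<Omega> wt p = {\<alpha>. monom \<alpha> \<in> Ap_space \<Omega> wt p}"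

definition laurent_series :: "(complex^'n::finite) set \<Rightarrow> (complex^'n \<Rightarrow> complex) \<Rightarrow> (('n \<Rightarrow> int) \<Rightarrow> complex) \<Rightarrow> bool" where
  "laurent_series \<Omega> f c \<longleftrightarrow>
     (\<forall>z\<in>\<Omega>. ((\<lambda>\<alpha>. c \<alpha> * monom \<alpha> z) has_sum f z) UNIV) \<and>
     (\<forall>K. compact K \<and> K \<subseteq> \<Omega> \<and> K \<noteq> {} \<longrightarrow>
        (\<lambda>\<alpha>. SUP z\<in>K. norm (c \<alpha> * monom \<alpha> z)) summable_on UNIV)"

definition laurent_coeff :: "(complex^'n::finite) set \<Rightarrow> ('n \<Rightarrow> int) \<Rightarrow> (complex^'n \<Rightarrow> complex) \<Rightarrow> complex" where
  "laurent_coeff \<Omega> \<alpha> f = (THE c. laurent_series \<Omega> f c) \<alpha>"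

definition coeff_opnorm :: "(complex^'n::finite) set \<Rightarrow> (complex^'n \<Rightarrow> ennreal) \<Rightarrow> real \<Rightarrow> ('n \<Rightarrow> int) \<Rightarrow> real" where
  "coeff_opnorm \<Omega> wt p \<alpha> = Sup ({norm (laurent_coeff \<Omega> \<alpha> f) / Lpnorm \<Omega> wt p f | f.
       f \<in> Ap_space \<Omega> wt p \<and> Lpnorm \<Omega> wt p f > 0} \<union> {0})"

text \<open>The norm-preserving (Hahn-Banach) extension of a_alpha to L^p
  (normalised to be 0 outside L^p so that it is unique as a HOL function).\<close>
definition ext_coeff :: "(complex^'n::finite) set \<Rightarrow> (complex^'n \<Rightarrow> ennreal) \<Rightarrow> real \<Rightarrow> ('n \<Rightarrow> int)
     \<Rightarrow> (complex^'n \<Rightarrow> complex) \<Rightarrow> complex" where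
  "ext_coeff \<Omega> wt p \<alpha> = (THE \<Phi>.
      (\<forall>f. f \<notin> Lp_space \<Omega> wt p \<longrightarrow> \<Phi> f = 0) \<and>
      (\<forall>f\<in>Ap_space \<Omega> wt p. \<Phi> f = laurent_coeff \<Omega> \<alpha> f) \<and>
      (\<forall>f\<in>Lp_space \<Omega> wt p. \<forall>g\<in>Lp_space \<Omega> wt p. \<Phi> (\<lambda>z. f z + g z) = \<Phi> f + \<Phi> g) \<and>
      (\<forall>f\<in>Lp_space \<Omega> wt p. \<forall>c. \<Phi> (\<lambda>z. c * f z) = c * \<Phi> f) \<and>
      (\<forall>f\<in>Lp_space \<Omega> wt p. norm (\<Phi> f) \<le> coeff_opnorm \<Omega> wt p \<alpha> * Lpnorm \<Omega> wt p f))"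

definition trunc_set :: "(complex^'n::finite) set \<Rightarrow> (complex^'n \<Rightarrow> ennreal) \<Rightarrow> real \<Rightarrow> nat \<Rightarrow> ('n \<Rightarrow> int) set" where
  "trunc_set \<Omega> wt p N = {\<alpha> \<in> Sp_set \<Omega> wt p. supnorm \<alpha> \<le> int N}"

definition is_MBP :: "(complex^'n::finite) set \<Rightarrow> (complex^'n \<Rightarrow> ennreal) \<Rightarrow> real
     \<Rightarrow> ((complex^'n \<Rightarrow> complex) \<Rightarrow> (complex^'n \<Rightarrow> complex)) \<Rightarrow> bool" where
  "is_MBP \<Omega> wt p P \<longleftrightarrow>
     (\<forall>f\<in>Lp_space \<Omega> wt p. P f \<in> Ap_space \<Omega> wt p) \<and>
     (\<forall>f\<in>Lp_space \<Omega> wt p. \<forall>g\<in>Lp_space \<Omega> wt p. \<forall>z\<in>\<Omega>. P (\<lambda>w. f w + g w) z = P f z + P g z) \<and>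
     (\<forall>f\<in>Lp_space \<Omega> wt p. \<forall>c. \<forall>z\<in>\<Omega>. P (\<lambda>w. c * f w) z = c * P f z) \<and>
     (\<exists>C. \<forall>f\<in>Lp_space \<Omega> wt p. Lpnorm \<Omega> wt p (P f) \<le> C * Lpnorm \<Omega> wt p f) \<and>
     (\<forall>g\<in>Ap_space \<Omega> wt p. \<forall>z\<in>\<Omega>. P g z = g z) \<and>
     (\<forall>f\<in>Lp_space \<Omega> wt p.
        (\<lambda>N. Lpnorm \<Omega> wt p (\<lambda>z. P f z -
            (\<Sum>\<alpha>\<in>trunc_set \<Omega> wt p N. ext_coeff \<Omega> wt p \<alpha> f * monom \<alpha> z))) \<longlonglongrightarrow> 0)"

definition mb_kernel :: "(complex^'n::finite) set \<Rightarrow> (complex^'n \<Rightarrow> ennreal) \<Rightarrow> real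
     \<Rightarrow> complex^'n \<Rightarrow> complex^'n \<Rightarrow> complex" where
  "mb_kernel \<Omega> wt p z w = lim (\<lambda>N. \<Sum>\<alpha>\<in>trunc_set \<Omega> wt p N.
      monom \<alpha> z * cnj (monom \<alpha> w) * of_real (norm (monom \<alpha> w) powr (p - 2))
        / of_real (Lpnorm \<Omega> wt p (monom \<alpha>) powr p))"

end

theory Submission
  imports Defs
begin

text \<open>
  Write \<open>\<parallel>\<cdot>\<parallel>\<close> for the norm of \<open>L\<^sup>p(\<Omega>, \<lambda>)\<close>. The weighted measure is invariant under the unit torus, so
  the functional \<open>\<ell>\<^sub>\<alpha>(f) = \<parallel>e\<^sub>\<alpha>\<parallel>\<^sup>-\<^sup>p \<integral> f cnj(e\<^sub>\<alpha>) \<bar>e\<^sub>\<alpha>\<bar>\<^sup>p\<^sup>-\<^sup>2 \<lambda>\<close> takes the value 1 at \<open>e\<^sub>\<alpha>\<close> and 0 at all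
  other monomials, and by Hoelder its norm is \<open>1 / \<parallel>e\<^sub>\<alpha>\<parallel>\<close>. Since every \<open>g\<close> in \<open>A\<^sup>p\<close> is fixed by the
  projection, it is a norm limit of Laurent polynomials; this identifies its Laurent coefficients
  with \<open>\<ell>\<^sub>\<alpha>(g)\<close>, and smoothness of the \<open>L\<^sup>p\<close> norm makes \<open>\<ell>\<^sub>\<alpha>\<close> the only norm-preserving extension.

  The series of the kernel converges because admissibility, applied to a slightly larger polydisc,
  gives \<open>\<bar>e\<^sub>\<alpha>(z)\<bar> \<le> C \<rho>\<^sup>\<bar>\<^sup>\<alpha>\<^sup>\<bar> \<parallel>e\<^sub>\<alpha>\<parallel>\<close> with \<open>\<rho> < 1\<close>: the \<open>L\<^sup>q\<close> norms of its terms are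
  \<open>\<bar>e\<^sub>\<alpha>(z)\<bar> / \<parallel>e\<^sub>\<alpha>\<parallel>\<close>, hence summable. The integral formula follows by dominated convergence.
\<close>

section \<open>Functions with integrable \<open>p\<close>-th power\<close>

lemma powr_tangent_le:
  fixes x y p :: real
  assumes "1 < p" "0 \<le> x" "0 \<le> y"
  shows "p * y powr (p - 1) * (x - y) \<le> x powr p - y powr p"
proof -
  define q where "q = p / (p - 1)"
  have q: "1 < q" "1/p + 1/q = 1" "(p - 1) * q = p" "p / q = p - 1"
    using assms by (auto simp: q_def field_simps)
  have "x * y powr (p - 1) \<le> x powr p / p + (y powr (p - 1)) powr q / q"
    by (rule Youngs_inequality) (use assms q in auto)
  then have "p * (x * y powr (p - 1)) \<le> p * (x powr p / p + y powr p / q)"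
    using assms by (intro mult_left_mono) (auto simp: powr_powr q(3))
  also have "\<dots> = x powr p + (p - 1) * y powr p"
    using assms by (simp add: distrib_left flip: q(4))
  finally show ?thesis
    using powr_mult_base[OF \<open>0 \<le> y\<close>, of "p - 1"] by (simp add: algebra_simps)
qed

lemma powr_convex_combination_le:
  fixes t x y p :: real
  assumes "1 < p" "0 \<le> x" "0 \<le> y" "0 \<le> t" "t \<le> 1"
  shows "(t * x + (1 - t) * y) powr p \<le> t * x powr p + (1 - t) * y powr p"
proof -
  define m where "m = t * x + (1 - t) * y"
  define slope where "slope = p * m powr (p - 1)"
  have "0 \<le> m" using assms by (simp add: m_def)
  then have "t * (slope * (x - m)) + (1 - t) * (slope * (y - m))
      \<le> t * (x powr p - m powr p) + (1 - t) * (y powr p - m powr p)"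
    using assms unfolding slope_def by (intro add_mono mult_left_mono powr_tangent_le) auto
  moreover have "t * (slope * (x - m)) + (1 - t) * (slope * (y - m)) = 0"
    unfolding m_def by algebra
  ultimately have "m powr p \<le> t * x powr p + (1 - t) * y powr p"
    by (simp add: right_diff_distrib left_diff_distrib)
  then show ?thesis unfolding m_def .
qed

lemma powr_add_le:
  fixes a b p :: real
  assumes "0 \<le> a" "0 \<le> b" "0 \<le> p"
  shows "(a + b) powr p \<le> 2 powr p * (a powr p + b powr p)"
proof -
  have "(a + b) powr p \<le> (2 * max a b) powr p"
    using assms by (intro powr_mono2) auto
  also have "\<dots> = 2 powr p * max a b powr p"
    using assms by (simp add: powr_mult)
  also have "\<dots> \<le> 2 powr p * (a powr p + b powr p)"
    by (intro mult_left_mono) (auto simp: max_def)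
  finally show ?thesis .
qed

lemma powr_add_le_weighted:
  fixes a b p x y :: real
  assumes "1 < p" "0 < a" "0 < b" "0 \<le> x" "0 \<le> y"
  shows "(x + y) powr p
    \<le> (a + b) powr p * (a / (a + b) * (x powr p / a powr p) + b / (a + b) * (y powr p / b powr p))"
proof -
  define t where "t = a / (a + b)"
  have t: "0 \<le> t" "t \<le> 1" "1 - t = b / (a + b)"
    using assms by (auto simp: t_def field_simps)
  have "x + y = (a + b) * (t * (x / a) + (1 - t) * (y / b))"
    unfolding t(3) using assms by (simp add: t_def distrib_left)
  then have "(x + y) powr p = (a + b) powr p * (t * (x / a) + (1 - t) * (y / b)) powr p"
    using assms t(1,2) by (simp add: powr_mult)
  also have "\<dots> \<le> (a + b) powr p * (t * (x / a) powr p + (1 - t) * (y / b) powr p)"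
    using assms t(1,2) by (intro mult_left_mono powr_convex_combination_le) auto
  finally show ?thesis
    using assms unfolding t(3) by (simp add: t_def powr_divide)
qed

definition p_integrable :: "real \<Rightarrow> 'a measure \<Rightarrow> ('a \<Rightarrow> 'b::real_normed_vector) \<Rightarrow> bool" where
  "p_integrable p M f \<longleftrightarrow> f \<in> borel_measurable M \<and> integrable M (\<lambda>x. norm (f x) powr p)"

definition p_norm :: "real \<Rightarrow> 'a measure \<Rightarrow> ('a \<Rightarrow> 'b::real_normed_vector) \<Rightarrow> real" where
  "p_norm p M f = (\<integral>x. norm (f x) powr p \<partial>M) powr (1/p)"

lemma p_integrable_measurable: "p_integrable p M f \<Longrightarrow> f \<in> borel_measurable M"
  and p_integrable_integrable: "p_integrable p M f \<Longrightarrow> integrable M (\<lambda>x. norm (f x) powr p)"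
  by (simp_all add: p_integrable_def)

lemma p_norm_nonneg: "0 \<le> p_norm p M f"
  by (simp add: p_norm_def)

lemma p_norm_powr: "p \<noteq> 0 \<Longrightarrow> p_norm p M f powr p = (\<integral>x. norm (f x) powr p \<partial>M)"
  by (simp add: p_norm_def powr_powr)

lemma p_norm_le:
  assumes "0 < p" "0 \<le> c" "(\<integral>x. norm (f x) powr p \<partial>M) \<le> c powr p"
  shows "p_norm p M f \<le> c"
proof -
  have "p_norm p M f \<le> (c powr p) powr (1/p)"
    unfolding p_norm_def using assms by (intro powr_mono2) auto
  then show ?thesis using assms by (simp add: powr_powr)
qed

lemma p_norm_eq_0_iff:
  assumes "p_integrable p M f"
  shows "p_norm p M f = 0 \<longleftrightarrow> (AE x in M. f x = 0)"
  using integral_nonneg_eq_0_iff_AE[OF p_integrable_integrable[OF assms]] by (simp add: p_norm_def)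

lemma p_norm_cong_AE:
  assumes "f \<in> borel_measurable M" "g \<in> borel_measurable M" "AE x in M. norm (f x) = norm (g x)"
  shows "p_norm p M f = p_norm p M g"
proof -
  have "(\<integral>x. norm (f x) powr p \<partial>M) = (\<integral>x. norm (g x) powr p \<partial>M)"
    by (rule integral_cong_AE) (use assms in auto)
  then show ?thesis by (simp add: p_norm_def)
qed

lemma p_norm_add_null:
  fixes f g :: "'a \<Rightarrow> 'b::{real_normed_vector, second_countable_topology}"
  assumes f: "p_integrable p M f" and g: "p_integrable p M g" and zero: "p_norm p M f = 0"
  shows "p_norm p M (\<lambda>x. f x + g x) = p_norm p M g"
proof -
  note [measurable] = p_integrable_measurable[OF f] p_integrable_measurable[OF g]
  have "AE x in M. f x = 0"
    using zero by (simp add: p_norm_eq_0_iff[OF f])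
  then show ?thesis by (intro p_norm_cong_AE) auto
qed

lemma p_norm_cmult:
  fixes f :: "'a \<Rightarrow> 'b::real_normed_field"
  assumes "p \<noteq> 0"
  shows "p_norm p M (\<lambda>x. c * f x) = norm c * p_norm p M f"
  using assms by (simp add: p_norm_def norm_mult powr_mult powr_powr)

lemma p_integrable_bound:
  assumes g: "p_integrable p M g" and "f \<in> borel_measurable M" "0 \<le> p"
    and "AE x in M. norm (f x) \<le> norm (g x)"
  shows "p_integrable p M f"
  unfolding p_integrable_def
proof
  show "integrable M (\<lambda>x. norm (f x) powr p)"
    by (rule Bochner_Integration.integrable_bound[OF p_integrable_integrable[OF g]])
      (use assms in \<open>auto intro!: powr_mono2 elim!: eventually_mono\<close>)
qed (rule assms)

lemma p_integrable_zero: "p_integrable p M (\<lambda>x. 0)"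
  by (simp add: p_integrable_def)

lemma p_integrable_cmult:
  fixes f :: "'a \<Rightarrow> 'b::{real_normed_field, second_countable_topology}"
  assumes "p_integrable p M f"
  shows "p_integrable p M (\<lambda>x. c * f x)"
  using assms by (auto simp: p_integrable_def norm_mult powr_mult)

lemma p_integrable_add:
  fixes f g :: "'a \<Rightarrow> 'b::{real_normed_vector, second_countable_topology}"
  assumes f: "p_integrable p M f" and g: "p_integrable p M g" and "0 \<le> p"
  shows "p_integrable p M (\<lambda>x. f x + g x)"
proof -
  note [measurable] = p_integrable_measurable[OF f] p_integrable_measurable[OF g]
  have "norm (f x + g x) powr p \<le> 2 powr p * (norm (f x) powr p + norm (g x) powr p)" for x
    using powr_mono2[OF \<open>0 \<le> p\<close> norm_ge_zero norm_triangle_ineq] powr_add_le[OF _ _ \<open>0 \<le> p\<close>]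
    by (meson norm_ge_zero order_trans)
  moreover have "integrable M (\<lambda>x. 2 powr p * (norm (f x) powr p + norm (g x) powr p))"
    using f g by (simp add: p_integrable_def)
  ultimately have "integrable M (\<lambda>x. norm (f x + g x) powr p)"
    by (elim Bochner_Integration.integrable_bound) (auto intro: order_trans)
  then show ?thesis by (simp add: p_integrable_def)
qed

lemma p_integrable_sum:
  fixes f :: "'i \<Rightarrow> 'a \<Rightarrow> 'b::{real_normed_vector, second_countable_topology}"
  assumes "\<And>i. i \<in> I \<Longrightarrow> p_integrable p M (f i)" "0 \<le> p"
  shows "p_integrable p M (\<lambda>x. \<Sum>i\<in>I. f i x)"
  using assms
  by (induction I rule: infinite_finite_induct) (auto intro: p_integrable_add p_integrable_zero)

lemma p_norm_add_le:
  fixes f g :: "'a \<Rightarrow> 'b::{real_normed_vector, second_countable_topology}"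
  assumes p: "1 < p" and f: "p_integrable p M f" and g: "p_integrable p M g"
  shows "p_norm p M (\<lambda>x. f x + g x) \<le> p_norm p M f + p_norm p M g"
proof -
  define a b where "a = p_norm p M f" and "b = p_norm p M g"
  consider "a = 0" | "b = 0" | "0 < a" "0 < b"
    unfolding a_def b_def by (metis p_norm_nonneg order_le_less)
  then show ?thesis
  proof cases
    assume "a = 0"
    then show ?thesis
      using p_norm_add_null[OF f g] by (simp add: a_def)
  next
    assume "b = 0"
    then show ?thesis
      using p_norm_add_null[OF g f] by (simp add: b_def add.commute)
  next
    assume pos: "0 < a" "0 < b"
    define bound where "bound x = (a + b) powr p *
      (a / (a + b) * (norm (f x) powr p / a powr p) + b / (a + b) * (norm (g x) powr p / b powr p))"
      for x
    have "norm (f x + g x) powr p \<le> bound x" for x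
      using powr_mono2[of p, OF _ norm_ge_zero norm_triangle_ineq] powr_add_le_weighted[OF p pos] p
      unfolding bound_def by (meson less_imp_le less_trans norm_ge_zero order_trans zero_less_one)
    moreover have "integrable M bound"
      using p_integrable_integrable[OF f] p_integrable_integrable[OF g] by (simp add: bound_def[abs_def])
    moreover have "(\<integral>x. bound x \<partial>M) = (a + b) powr p"
    proof -
      have "(\<integral>x. bound x \<partial>M) = (a + b) powr p * (a / (a + b) + b / (a + b))"
        using p_integrable_integrable[OF f] p_integrable_integrable[OF g] pos p
        by (simp add: bound_def a_def b_def flip: p_norm_powr)
      then show ?thesis using pos by (simp flip: add_divide_distrib)
    qed
    ultimately have "(\<integral>x. norm (f x + g x) powr p \<partial>M) \<le> (a + b) powr p"
      using integral_mono[OF p_integrable_integrable[OF p_integrable_add[OF f g]], of bound] p by simp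
    then show ?thesis
      using p pos unfolding a_def[symmetric] b_def[symmetric] by (intro p_norm_le) auto
  qed
qed

lemma p_norm_sum_le:
  fixes f :: "'i \<Rightarrow> 'a \<Rightarrow> 'b::{real_normed_vector, second_countable_topology}"
  assumes "1 < p" "\<And>i. i \<in> I \<Longrightarrow> p_integrable p M (f i)"
  shows "p_norm p M (\<lambda>x. \<Sum>i\<in>I. f i x) \<le> (\<Sum>i\<in>I. p_norm p M (f i))"
  using assms(2)
proof (induction I rule: infinite_finite_induct)
  case (insert i I)
  then show ?case
    using p_norm_add_le[OF \<open>1 < p\<close>, of M "f i" "\<lambda>x. \<Sum>i\<in>I. f i x"] p_integrable_sum[of I p M f] \<open>1 < p\<close>
    by simp
qed (simp_all add: p_norm_def)

lemma p_integrable_limit: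
  fixes f :: "nat \<Rightarrow> 'a \<Rightarrow> 'b::{real_normed_vector, second_countable_topology}"
  assumes "0 < p" and f: "\<And>n. p_integrable p M (f n)" and bound: "\<And>n. p_norm p M (f n) \<le> C"
    and lim: "AE x in M. (\<lambda>n. f n x) \<longlonglongrightarrow> g x" and [measurable]: "g \<in> borel_measurable M"
  shows "p_integrable p M g"
proof -
  note [measurable] = p_integrable_measurable[OF f]
  have "(\<integral>\<^sup>+x. ennreal (norm (g x) powr p) \<partial>M) = (\<integral>\<^sup>+x. liminf (\<lambda>n. ennreal (norm (f n x) powr p)) \<partial>M)"
  proof (rule nn_integral_cong_AE, use lim in eventually_elim)
    case (elim x)
    then have "(\<lambda>n. norm (f n x) powr p) \<longlonglongrightarrow> norm (g x) powr p"
      using \<open>0 < p\<close> by (intro tendsto_powr' tendsto_intros) auto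
    then show ?case by (intro lim_imp_Liminf[symmetric] tendsto_ennrealI) auto
  qed
  also have "\<dots> \<le> liminf (\<lambda>n. \<integral>\<^sup>+x. ennreal (norm (f n x) powr p) \<partial>M)"
    by (rule nn_integral_liminf) measurable
  also have "\<dots> = liminf (\<lambda>n. ennreal (p_norm p M (f n) powr p))"
    using p_integrable_integrable[OF f] \<open>0 < p\<close> by (simp add: nn_integral_eq_integral p_norm_powr)
  also have "\<dots> \<le> liminf (\<lambda>n. ennreal (C powr p))"
    using bound \<open>0 < p\<close>
    by (intro Liminf_mono always_eventually allI ennreal_leI powr_mono2 p_norm_nonneg) auto
  finally have "(\<integral>\<^sup>+x. ennreal (norm (g x) powr p) \<partial>M) < \<infinity>"
    by (simp add: Liminf_const order.strict_trans1)
  then show ?thesis by (simp add: p_integrable_def integrable_iff_bounded)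
qed

lemma integrable_mult_p_integrable:
  fixes f g :: "'a \<Rightarrow> 'b::{real_normed_algebra, banach, second_countable_topology}"
  assumes pq: "1 < p" "1 < q" "1/p + 1/q = 1" and f: "p_integrable p M f" and g: "p_integrable q M g"
  shows "integrable M (\<lambda>x. f x * g x)"
proof (rule Bochner_Integration.integrable_bound)
  note [measurable] = p_integrable_measurable[OF f] p_integrable_measurable[OF g]
  show "(\<lambda>x. f x * g x) \<in> borel_measurable M" by measurable
  show "integrable M (\<lambda>x. norm (f x) powr p / p + norm (g x) powr q / q)"
    using f g by (simp add: p_integrable_def)
  have "norm (f x * g x) \<le> norm (f x) powr p / p + norm (g x) powr q / q" for x
    by (rule order_trans[OF norm_mult_ineq Youngs_inequality[OF pq norm_ge_zero norm_ge_zero]])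
  then show "AE x in M. norm (f x * g x) \<le> norm (norm (f x) powr p / p + norm (g x) powr q / q)"
    unfolding real_norm_def by (intro AE_I2 order_trans[OF _ abs_ge_self])
qed

lemma Holder_inequality:
  fixes f g :: "'a \<Rightarrow> 'b::{real_normed_algebra, banach, second_countable_topology}"
  assumes pq: "1 < p" "1 < q" "1/p + 1/q = 1" and f: "p_integrable p M f" and g: "p_integrable q M g"
  shows "norm (\<integral>x. f x * g x \<partial>M) \<le> p_norm p M f * p_norm q M g"
proof -
  define a b where "a = p_norm p M f" and "b = p_norm q M g"
  consider "a = 0 \<or> b = 0" | "0 < a" "0 < b"
    unfolding a_def b_def by (metis p_norm_nonneg order_le_less)
  then show ?thesis
  proof cases
    assume "a = 0 \<or> b = 0"
    then have "AE x in M. f x * g x = 0"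
      using p_norm_eq_0_iff[OF f] p_norm_eq_0_iff[OF g] by (auto simp: a_def b_def)
    then show ?thesis by (simp add: integral_eq_zero_AE p_norm_nonneg)
  next
    assume pos: "0 < a" "0 < b"
    define bound where
      "bound x = a * b * (norm (f x) powr p / a powr p / p + norm (g x) powr q / b powr q / q)" for x
    have "norm (f x * g x) \<le> bound x" for x
    proof -
      have "norm (f x) / a * (norm (g x) / b)
          \<le> (norm (f x) / a) powr p / p + (norm (g x) / b) powr q / q"
        by (rule Youngs_inequality) (use pos pq in auto)
      then have "norm (f x) * norm (g x) \<le> bound x"
        using pos by (simp add: bound_def powr_divide divide_le_eq mult_ac)
      then show ?thesis using norm_mult_ineq order_trans by blast
    qed
    moreover have "integrable M bound"
      using p_integrable_integrable[OF f] p_integrable_integrable[OF g] by (simp add: bound_def[abs_def])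
    moreover have "(\<integral>x. bound x \<partial>M) = a * b"
    proof -
      have "(\<integral>x. bound x \<partial>M) = a * b * (1/p + 1/q)"
        using p_integrable_integrable[OF f] p_integrable_integrable[OF g] pos pq
        by (simp add: bound_def a_def b_def flip: p_norm_powr)
      then show ?thesis by (simp only: pq(3) mult_1_right)
    qed
    ultimately have "(\<integral>x. norm (f x * g x) \<partial>M) \<le> a * b"
      using integral_mono[OF integrable_norm[OF integrable_mult_p_integrable[OF pq f g]], of bound]
      by simp
    then show ?thesis
      unfolding a_def b_def by (rule order_trans[OF integral_norm_bound])
  qed
qed

section \<open>The duality map and smoothness of the norm\<close>

definition duality_map :: "real \<Rightarrow> complex \<Rightarrow> complex" where
  "duality_map p a = cnj a * of_real (norm a powr (p - 2))"

lemma norm_duality_map: "norm (duality_map p a) = norm a powr (p - 1)"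
  by (cases "a = 0") (simp_all add: duality_map_def norm_mult powr_mult_base)

lemma mult_duality_map: "a * duality_map p a = of_real (norm a powr p)"
proof (cases "a = 0")
  case False
  have "a * duality_map p a = of_real ((norm a)\<^sup>2 * norm a powr (p - 2))"
    by (simp add: duality_map_def complex_norm_square[symmetric] mult.assoc[symmetric])
  also have "(norm a)\<^sup>2 * norm a powr (p - 2) = norm a powr p"
    using False by (simp add: powr_diff)
  finally show ?thesis .
qed simp

lemma duality_map_mult_unimodular:
  assumes "norm c = 1"
  shows "duality_map p (c * a) = cnj c * duality_map p a"
  using assms by (simp add: duality_map_def norm_mult)

lemma borel_measurable_duality_map [measurable]: "duality_map p \<in> borel_measurable borel"
proof -
  have [measurable]: "cnj \<in> borel_measurable borel"
    by (intro borel_measurable_continuous_onI continuous_intros)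
  show ?thesis unfolding duality_map_def[abs_def] by measurable
qed

lemma isCont_duality_map:
  assumes "1 < p"
  shows "isCont (duality_map p) a"
proof (cases "a = 0")
  case True
  have "((\<lambda>x::complex. norm x powr (p - 1)) \<longlongrightarrow> norm (0::complex) powr (p - 1)) (at 0)"
    using assms by (intro tendsto_powr' tendsto_intros) auto
  then have "((\<lambda>x. norm (duality_map p x)) \<longlongrightarrow> 0) (at 0)"
    by (simp add: norm_duality_map)
  then have "(duality_map p \<longlongrightarrow> 0) (at 0)"
    by (rule tendsto_norm_zero_cancel)
  then show ?thesis by (simp add: True isCont_def duality_map_def)
next
  case False
  then show ?thesis
    unfolding isCont_def duality_map_def by (intro tendsto_intros) auto
qed

lemma duality_map_subgradient:
  assumes "1 < p"
  shows "p * Re ((b - a) * duality_map p a) \<le> norm b powr p - norm a powr p"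
proof -
  have "Re (a * duality_map p a) = norm a * norm a powr (p - 1)"
    by (simp add: mult_duality_map powr_mult_base)
  moreover have "Re (b * duality_map p a) \<le> norm b * norm a powr (p - 1)"
    using complex_Re_le_cmod[of "b * duality_map p a"] by (simp add: norm_mult norm_duality_map)
  ultimately have "Re ((b - a) * duality_map p a) \<le> norm a powr (p - 1) * (norm b - norm a)"
    by (simp add: left_diff_distrib right_diff_distrib mult.commute)
  then have "p * Re ((b - a) * duality_map p a) \<le> p * norm a powr (p - 1) * (norm b - norm a)"
    using assms by (simp add: mult.assoc)
  also have "\<dots> \<le> norm b powr p - norm a powr p"
    by (rule powr_tangent_le) (use assms in auto)
  finally show ?thesis .
qed

lemma
  assumes "1 < p" and f: "p_integrable p M f"
  shows p_integrable_duality_map: "p_integrable (p / (p - 1)) M (\<lambda>x. duality_map p (f x))"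
    and p_norm_duality_map:
      "p_norm (p / (p - 1)) M (\<lambda>x. duality_map p (f x)) = p_norm p M f powr (p - 1)"
proof -
  note [measurable] = p_integrable_measurable[OF f]
  have "norm (duality_map p (f x)) powr (p / (p - 1)) = norm (f x) powr p" for x
    using assms(1) by (simp add: norm_duality_map powr_powr)
  then show "p_integrable (p / (p - 1)) M (\<lambda>x. duality_map p (f x))"
    and "p_norm (p / (p - 1)) M (\<lambda>x. duality_map p (f x)) = p_norm p M f powr (p - 1)"
    using f assms(1) by (simp_all add: p_integrable_def p_norm_def powr_powr)
qed

lemma conjugate_exponent:
  fixes p :: real
  assumes "1 < p"
  shows "1 < p / (p - 1)" "1/p + 1 / (p / (p - 1)) = 1"
  using assms by (auto simp: field_simps)

lemma integrable_mult_duality_map: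
  assumes "1 < p" "p_integrable p M f" "p_integrable p M e"
  shows "integrable M (\<lambda>x. f x * duality_map p (e x))"
  using integrable_mult_p_integrable[OF assms(1) conjugate_exponent[OF assms(1)] assms(2)]
    p_integrable_duality_map[OF assms(1,3)] by blast

lemma Holder_duality_map:
  assumes "1 < p" "p_integrable p M f" "p_integrable p M e"
  shows "norm (\<integral>x. f x * duality_map p (e x) \<partial>M) \<le> p_norm p M f * p_norm p M e powr (p - 1)"
  using Holder_inequality[OF assms(1) conjugate_exponent[OF assms(1)] assms(2)
      p_integrable_duality_map[OF assms(1,3)]]
  by (simp add: p_norm_duality_map assms(1,3))

lemma p_norm_powr_diff_le:
  assumes p: "1 < p" and f: "p_integrable p M f" and g: "p_integrable p M g"
  shows "p_norm p M g powr p - p_norm p M f powr p \<le> p * Re (\<integral>x. (g x - f x) * duality_map p (g x) \<partial>M)"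
proof -
  have int: "integrable M (\<lambda>x. (g x - f x) * duality_map p (g x))"
    unfolding left_diff_distrib
    by (intro Bochner_Integration.integrable_diff integrable_mult_duality_map p f g)
  have "(\<integral>x. norm (g x) powr p - norm (f x) powr p \<partial>M)
      \<le> (\<integral>x. p * Re ((g x - f x) * duality_map p (g x)) \<partial>M)"
  proof (rule integral_mono)
    show "integrable M (\<lambda>x. p * Re ((g x - f x) * duality_map p (g x)))"
      using int by (intro integrable_mult_right integrable_Re)
    show "norm (g x) powr p - norm (f x) powr p \<le> p * Re ((g x - f x) * duality_map p (g x))" for x
      using duality_map_subgradient[OF p, of "f x" "g x"] by (simp add: algebra_simps)
  qed (use p_integrable_integrable[OF f] p_integrable_integrable[OF g] in auto)
  then show ?thesis
    using p p_integrable_integrable[OF f] p_integrable_integrable[OF g]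
    by (simp add: p_norm_powr int del: minus_complex.sel times_complex.sel)
qed

lemma tendsto_integral_duality_map:
  assumes p: "1 < p" and h: "p_integrable p M h" and e: "p_integrable p M e"
    and s: "s \<longlonglongrightarrow> 0" "\<And>n. \<bar>s n\<bar> \<le> 1"
  shows "(\<lambda>n. \<integral>x. h x * duality_map p (e x + of_real (s n) * h x) \<partial>M)
    \<longlonglongrightarrow> (\<integral>x. h x * duality_map p (e x) \<partial>M)"
proof (rule integral_dominated_convergence)
  note [measurable] = p_integrable_measurable[OF h] p_integrable_measurable[OF e]
  show "(\<lambda>x. h x * duality_map p (e x)) \<in> borel_measurable M"
    and "(\<lambda>x. h x * duality_map p (e x + of_real (s n) * h x)) \<in> borel_measurable M" for n
    by measurable
  show "integrable M (\<lambda>x. 2 powr p * (norm (e x) powr p + norm (h x) powr p))"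
    using h e by (simp add: p_integrable_def)
  show "AE x in M. (\<lambda>n. h x * duality_map p (e x + of_real (s n) * h x)) \<longlonglongrightarrow> h x * duality_map p (e x)"
  proof (rule AE_I2)
    fix x
    have "(\<lambda>n. e x + of_real (s n) * h x) \<longlonglongrightarrow> e x + of_real 0 * h x"
      by (intro tendsto_intros s)
    then show "(\<lambda>n. h x * duality_map p (e x + of_real (s n) * h x)) \<longlonglongrightarrow> h x * duality_map p (e x)"
      using isCont_tendsto_compose[OF isCont_duality_map[OF p]]
      by (intro tendsto_mult tendsto_const) simp
  qed
  fix n
  show "AE x in M. norm (h x * duality_map p (e x + of_real (s n) * h x))
      \<le> 2 powr p * (norm (e x) powr p + norm (h x) powr p)"
  proof (rule AE_I2)
    fix x
    let ?c = "norm (e x) + norm (h x)"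
    have "norm (e x + of_real (s n) * h x) \<le> ?c"
      using norm_triangle_ineq[of "e x" "of_real (s n) * h x"]
        mult_right_mono[OF s(2)[of n] norm_ge_zero[of "h x"]]
      by (simp add: norm_mult)
    then have "norm (h x * duality_map p (e x + of_real (s n) * h x)) \<le> ?c * ?c powr (p - 1)"
      unfolding norm_mult norm_duality_map using p by (intro mult_mono powr_mono2) auto
    also have "\<dots> = ?c powr p"
      by (simp add: powr_mult_base)
    also have "\<dots> \<le> 2 powr p * (norm (e x) powr p + norm (h x) powr p)"
      by (rule powr_add_le) (use p in auto)
    finally show "norm (h x * duality_map p (e x + of_real (s n) * h x))
      \<le> 2 powr p * (norm (e x) powr p + norm (h x) powr p)" .
  qed
qed

text \<open>The subgradient inequality bounds the difference quotient of the \<open>p\<close>-th power of the norm at \<open>e\<close>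
  by the pairing of \<open>h\<close> with the duality map at \<open>e + s h\<close>, which is continuous in \<open>s\<close>.\<close>
lemma p_norm_slope_le:
  assumes p: "1 < p" and h: "p_integrable p M h" and e: "p_integrable p M e" and "0 \<le> \<kappa>"
    and growth: "\<And>s. 0 < s \<Longrightarrow> (1 + \<kappa> * s) * p_norm p M e \<le> p_norm p M (\<lambda>x. e x + of_real s * h x)"
  shows "\<kappa> * p_norm p M e powr p \<le> Re (\<integral>x. h x * duality_map p (e x) \<partial>M)"
proof (rule LIMSEQ_le_const)
  have "(\<lambda>n. \<integral>x. h x * duality_map p (e x + of_real (inverse (real (Suc n))) * h x) \<partial>M)
      \<longlonglongrightarrow> (\<integral>x. h x * duality_map p (e x) \<partial>M)"
    by (rule tendsto_integral_duality_map[OF p h e LIMSEQ_inverse_real_of_nat]) (simp add: field_simps)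
  then show "(\<lambda>n. Re (\<integral>x. h x * duality_map p (e x + of_real (inverse (real (Suc n))) * h x) \<partial>M))
      \<longlonglongrightarrow> Re (\<integral>x. h x * duality_map p (e x) \<partial>M)"
    by (rule tendsto_Re)
  have slope: "\<kappa> * p_norm p M e powr p \<le> Re (\<integral>x. h x * duality_map p (e x + of_real s * h x) \<partial>M)"
    if "0 < s" for s
  proof -
    let ?g = "\<lambda>x. e x + of_real s * h x"
    have g: "p_integrable p M ?g"
      using p by (intro p_integrable_add p_integrable_cmult e h) auto
    have "(1 + p * (\<kappa> * s)) * p_norm p M e powr p \<le> (1 + \<kappa> * s) powr p * p_norm p M e powr p"
      using powr_tangent_le[OF p, of "1 + \<kappa> * s" 1] \<open>0 \<le> \<kappa>\<close> that by (intro mult_right_mono) auto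
    also have "\<dots> = ((1 + \<kappa> * s) * p_norm p M e) powr p"
      using \<open>0 \<le> \<kappa>\<close> that by (simp add: powr_mult p_norm_nonneg)
    also have "\<dots> \<le> p_norm p M ?g powr p"
      using p \<open>0 \<le> \<kappa>\<close> that growth by (intro powr_mono2) (auto simp: p_norm_nonneg)
    also have "\<dots> \<le> p_norm p M e powr p + p * Re (\<integral>x. (?g x - e x) * duality_map p (?g x) \<partial>M)"
      using p_norm_powr_diff_le[OF p e g] by simp
    also have "(\<integral>x. (?g x - e x) * duality_map p (?g x) \<partial>M)
        = of_real s * (\<integral>x. h x * duality_map p (?g x) \<partial>M)"
      by (simp add: mult.assoc)
    finally have "(p * s) * (\<kappa> * p_norm p M e powr p) \<le> (p * s) * Re (\<integral>x. h x * duality_map p (?g x) \<partial>M)"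
      by (simp add: algebra_simps)
    then show ?thesis using p that by simp
  qed
  show "\<exists>N. \<forall>n\<ge>N. \<kappa> * p_norm p M e powr p
      \<le> Re (\<integral>x. h x * duality_map p (e x + of_real (inverse (real (Suc n))) * h x) \<partial>M)"
    by (intro exI allI impI slope) simp
qed

locale norming_functional =
  fixes p :: real and M :: "'a measure" and e :: "'a \<Rightarrow> complex" and \<Phi> :: "('a \<Rightarrow> complex) \<Rightarrow> complex"
  assumes exponent: "1 < p" and e: "p_integrable p M e" and norm_pos: "0 < p_norm p M e"
    and \<Phi>_e: "\<Phi> e = 1"
    and add: "p_integrable p M f \<Longrightarrow> p_integrable p M g \<Longrightarrow> \<Phi> (\<lambda>x. f x + g x) = \<Phi> f + \<Phi> g"
    and cmult: "p_integrable p M f \<Longrightarrow> \<Phi> (\<lambda>x. c * f x) = c * \<Phi> f"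
    and bound: "p_integrable p M f \<Longrightarrow> norm (\<Phi> f) * p_norm p M e \<le> p_norm p M f"
begin

lemma eq_0_if_pairing_eq_0:
  assumes k: "p_integrable p M k" and pairing: "(\<integral>x. k x * duality_map p (e x) \<partial>M) = 0"
  shows "\<Phi> k = 0"
proof -
  define h where "h x = cnj (\<Phi> k) * k x" for x
  have h: "p_integrable p M h"
    unfolding h_def by (rule p_integrable_cmult[OF k])
  have \<Phi>_h: "\<Phi> h = of_real ((norm (\<Phi> k))\<^sup>2)"
    unfolding h_def cmult[OF k] complex_norm_square by (simp add: mult.commute)
  have "(norm (\<Phi> k))\<^sup>2 * p_norm p M e powr p \<le> Re (\<integral>x. h x * duality_map p (e x) \<partial>M)"
  proof (rule p_norm_slope_le[OF exponent h e])
    fix s :: real assume "0 < s"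
    let ?g = "\<lambda>x. e x + of_real s * h x"
    have g: "p_integrable p M ?g"
      using exponent by (intro p_integrable_add p_integrable_cmult e h) auto
    have "\<Phi> ?g = of_real (1 + (norm (\<Phi> k))\<^sup>2 * s)"
      using add[OF e p_integrable_cmult[OF h]] cmult[OF h] \<Phi>_e \<Phi>_h by simp
    then have "norm (\<Phi> ?g) = 1 + (norm (\<Phi> k))\<^sup>2 * s"
      using \<open>0 < s\<close> by (simp only: norm_of_real) simp
    then show "(1 + (norm (\<Phi> k))\<^sup>2 * s) * p_norm p M e \<le> p_norm p M ?g"
      using bound[OF g] by simp
  qed simp
  also have "(\<integral>x. h x * duality_map p (e x) \<partial>M) = 0"
    by (simp add: h_def mult.assoc pairing)
  finally show ?thesis using norm_pos by (simp add: mult_le_0_iff)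
qed

lemma eq_normalized_pairing:
  assumes f: "p_integrable p M f"
  shows "\<Phi> f = (\<integral>x. f x * duality_map p (e x) \<partial>M) / of_real (p_norm p M e powr p)"
proof -
  define c where "c = (\<integral>x. f x * duality_map p (e x) \<partial>M) / of_real (p_norm p M e powr p)"
  define k where "k x = f x + (- c) * e x" for x
  have k: "p_integrable p M k"
    unfolding k_def using exponent by (intro p_integrable_add p_integrable_cmult e f) auto
  have "(\<integral>x. k x * duality_map p (e x) \<partial>M)
      = (\<integral>x. f x * duality_map p (e x) \<partial>M) + (- c) * (\<integral>x. e x * duality_map p (e x) \<partial>M)"
    unfolding k_def distrib_right mult.assoc
    using integrable_mult_duality_map[OF exponent f e] integrable_mult_duality_map[OF exponent e e]
    by (subst Bochner_Integration.integral_add) simp_all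
  also have "(\<integral>x. e x * duality_map p (e x) \<partial>M) = of_real (p_norm p M e powr p)"
    using exponent by (simp add: mult_duality_map p_norm_powr)
  finally have "(\<integral>x. k x * duality_map p (e x) \<partial>M) = 0"
    using norm_pos by (simp add: c_def)
  then have "\<Phi> k = 0"
    by (rule eq_0_if_pairing_eq_0[OF k])
  moreover have "\<Phi> k = \<Phi> f - c"
    unfolding k_def using add[OF f p_integrable_cmult[OF e, of "- c"]] cmult[OF e, of "- c"] \<Phi>_e by simp
  ultimately show ?thesis by (simp add: c_def)
qed

end

section \<open>Invariance of Lebesgue measure under isometries\<close>

lemma nn_integral_lborel_translate:
  fixes f :: "'a::euclidean_space \<Rightarrow> ennreal"
  assumes [measurable]: "f \<in> borel_measurable borel"
  shows "(\<integral>\<^sup>+x. f (a + x) \<partial>lborel) = (\<integral>\<^sup>+x. f x \<partial>lborel)"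
  by (subst lborel_distr_plus[of a, symmetric]) (simp add: nn_integral_distr)

lemma borel_measurable_orthogonal_transformation:
  fixes T :: "'a::euclidean_space \<Rightarrow> 'a"
  assumes "orthogonal_transformation T"
  shows "T \<in> borel_measurable borel"
  using orthogonal_transformation_linear[OF assms]
  by (intro borel_measurable_continuous_onI linear_continuous_on) (simp add: linear_conv_bounded_linear)

lemma nn_integral_indicator_unit_ball_orthogonal:
  fixes T :: "'a::euclidean_space \<Rightarrow> 'a"
  assumes T: "orthogonal_transformation T"
  shows "(\<integral>\<^sup>+x. indicator (ball 0 1) (y - T x) \<partial>lborel) = emeasure lborel (ball (0::'a) 1)"
proof -
  obtain a where "y = T a"
    using orthogonal_transformation_bij[OF T] by (metis bij_pointE)
  then have "norm (y - T x) = dist a x" for x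
    using T by (simp add: dist_norm orthogonal_transformation_norm orthogonal_transformation_linear
        flip: linear_diff)
  then have "(\<integral>\<^sup>+x. indicator (ball 0 1) (y - T x) \<partial>lborel) = (\<integral>\<^sup>+x. indicator (ball a 1) x \<partial>lborel)"
    by (intro nn_integral_cong) (simp add: indicator_def)
  then show ?thesis by (simp add: emeasure_ball)
qed

text \<open>Both sides of the invariance, multiplied by the volume of the unit ball \<open>B\<close>, equal the integral of
  \<open>indicator A (T x + y) * indicator B y\<close>: integrate first over \<open>x\<close> or first over \<open>y\<close>.\<close>
lemma distr_lborel_orthogonal_transformation:
  fixes T :: "'a::euclidean_space \<Rightarrow> 'a"
  assumes T: "orthogonal_transformation T"
  shows "distr lborel borel T = lborel"
proof (rule measure_eqI)
  fix A assume "A \<in> sets (distr lborel borel T)"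
  then have [measurable]: "A \<in> sets borel" by simp
  note [measurable] = borel_measurable_orthogonal_transformation[OF T]
  define B :: "'a set" where "B = ball 0 1"
  have [measurable]: "B \<in> sets borel" by (simp add: B_def)
  have "emeasure (distr lborel borel T) A * emeasure lborel B
      = (\<integral>\<^sup>+y. (\<integral>\<^sup>+x. indicator A (T x) \<partial>lborel) * indicator B y \<partial>lborel)"
    using nn_integral_distr[of T lborel borel "indicator A"] by (simp add: nn_integral_cmult)
  also have "\<dots> = (\<integral>\<^sup>+y. \<integral>\<^sup>+x. indicator A (T x + y) * indicator B y \<partial>lborel \<partial>lborel)"
  proof (rule nn_integral_cong)
    fix y
    obtain a where "y = T a"
      using orthogonal_transformation_bij[OF T] by (metis bij_pointE)
    then have "T x + y = T (a + x)" for x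
      using orthogonal_transformation_linear[OF T] by (simp add: linear_add)
    then show "(\<integral>\<^sup>+x. indicator A (T x) \<partial>lborel) * indicator B y
        = (\<integral>\<^sup>+x. indicator A (T x + y) * indicator B y \<partial>lborel)"
      using nn_integral_lborel_translate[of "\<lambda>x. indicator A (T x)" a] by (simp add: nn_integral_multc)
  qed
  also have "\<dots> = (\<integral>\<^sup>+x. \<integral>\<^sup>+y. indicator A (T x + y) * indicator B y \<partial>lborel \<partial>lborel)"
    by (rule lborel_pair.Fubini') measurable
  also have "\<dots> = (\<integral>\<^sup>+x. \<integral>\<^sup>+y. indicator A y * indicator B (y - T x) \<partial>lborel \<partial>lborel)"
    using nn_integral_lborel_translate[of "\<lambda>y. indicator A y * indicator B (y - T x)" "T x" for x]
    by simp
  also have "\<dots> = (\<integral>\<^sup>+y. \<integral>\<^sup>+x. indicator A y * indicator B (y - T x) \<partial>lborel \<partial>lborel)"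
    by (rule lborel_pair.Fubini'[symmetric]) measurable
  also have "\<dots> = (\<integral>\<^sup>+y. indicator A y * emeasure lborel B \<partial>lborel)"
    by (subst nn_integral_cmult)
      (simp_all add: nn_integral_indicator_unit_ball_orthogonal[OF T, folded B_def])
  also have "\<dots> = emeasure lborel A * emeasure lborel B"
    by (simp add: nn_integral_multc)
  finally show "emeasure (distr lborel borel T) A = emeasure lborel A"
    by (auto simp: B_def emeasure_ball mult_right_ennreal_cancel dest: leD)
qed simp

lemma
  fixes T :: "'a::euclidean_space \<Rightarrow> 'a"
  assumes T: "orthogonal_transformation T"
  shows measurable_lebesgue_orthogonal_transformation: "T \<in> lebesgue \<rightarrow>\<^sub>M lebesgue"
    and distr_lebesgue_orthogonal_transformation: "distr lebesgue lebesgue T = lebesgue"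
proof -
  note [measurable] = borel_measurable_orthogonal_transformation[OF T]
  have distr: "distr lebesgue lborel T = lborel"
    using distr_lborel_orthogonal_transformation[OF T] by (simp add: distr_completion cong: distr_cong)
  then have null: "null_sets lborel = null_sets (distr lebesgue lborel T)"
    by simp
  show "T \<in> lebesgue \<rightarrow>\<^sub>M lebesgue"
    by (simp add: completion.measurable_completion2 null measurable_completion)
  have "distr lebesgue lebesgue T = completion (distr lebesgue lborel T)"
    by (subst completion.completion_distr_eq) (auto simp: null measurable_completion)
  then show "distr lebesgue lebesgue T = lebesgue"
    by (simp add: distr)
qed

lemma distr_density_invariant:
  assumes T: "T \<in> M \<rightarrow>\<^sub>M M" "distr M M T = M" and h: "h \<in> borel_measurable M" "\<And>x. h (T x) = h x"
  shows "distr (density M h) (density M h) T = density M h"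
proof -
  have "distr (density M h) (density M h) T = distr (density M (\<lambda>x. h (T x))) M T"
    by (rule distr_cong) (simp_all add: h)
  also have "\<dots> = density (distr M M T) h"
    by (rule density_distr[symmetric, OF h(1) T(1)])
  finally show ?thesis by (simp add: T(2))
qed

section \<open>The unit torus and monomials\<close>

definition unit_torus :: "(complex^'n) set" where
  "unit_torus = {u. \<forall>j. norm (u$j) = 1}"

definition torus_invariant :: "(complex^'n) measure \<Rightarrow> bool" where
  "torus_invariant M \<longleftrightarrow> (\<forall>u\<in>unit_torus. (*) u \<in> M \<rightarrow>\<^sub>M M \<and> distr M M ((*) u) = M)"

lemma one_in_unit_torus: "1 \<in> unit_torus"
  by (simp add: unit_torus_def)

lemma mult_in_unit_torus: "u \<in> unit_torus \<Longrightarrow> v \<in> unit_torus \<Longrightarrow> u * v \<in> unit_torus"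
  by (simp add: unit_torus_def norm_mult)

lemma unit_torus_inverse:
  assumes "u \<in> unit_torus"
  obtains v where "v \<in> unit_torus" "\<And>z. v * (u * z) = z"
proof
  have "norm (u$j) \<noteq> 0" for j using assms by (simp add: unit_torus_def)
  then show "(\<chi> j. inverse (u$j)) * (u * z) = z" for z by (simp add: vec_eq_iff)
qed (use assms in \<open>simp add: unit_torus_def norm_inverse\<close>)

lemma orthogonal_transformation_mult_unit_torus:
  fixes u :: "complex^'n"
  assumes "u \<in> unit_torus"
  shows "orthogonal_transformation ((*) u)"
  unfolding orthogonal_transformation
proof
  show "linear ((*) u)"
    by (rule linearI) (simp_all add: vec_eq_iff distrib_left)
  show "\<forall>z. norm (u * z) = norm z"
    using assms by (simp add: norm_vec_def unit_torus_def norm_mult)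
qed

lemma torus_invariant_density:
  assumes "h \<in> borel_measurable lebesgue" "\<And>u z. u \<in> unit_torus \<Longrightarrow> h (u * z) = h z"
  shows "torus_invariant (density lebesgue h)"
  using assms
  by (auto simp: torus_invariant_def orthogonal_transformation_mult_unit_torus distr_density_invariant
      measurable_lebesgue_orthogonal_transformation distr_lebesgue_orthogonal_transformation)

lemma monom_mult: "monom \<alpha> (z * w) = monom \<alpha> z * monom \<alpha> w"
  by (simp add: monom_def power_int_mult_distrib prod.distrib)

lemma norm_monom: "norm (monom \<alpha> z) = (\<Prod>j\<in>UNIV. norm (z$j) powi \<alpha> j)"
  by (simp add: monom_def norm_power_int flip: prod_norm)

lemma norm_monom_unit_torus: "u \<in> unit_torus \<Longrightarrow> norm (monom \<alpha> u) = 1"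
  by (simp add: norm_monom unit_torus_def)

lemma monom_one: "monom \<alpha> 1 = 1"
  by (simp add: monom_def)

lemma monom_opposite_on_unit_torus:
  fixes \<alpha> \<beta> :: "'n::finite \<Rightarrow> int"
  assumes "\<alpha> \<noteq> \<beta>"
  obtains u where "u \<in> unit_torus" "monom \<alpha> u = - monom \<beta> u"
proof -
  obtain j where j: "\<alpha> j \<noteq> \<beta> j" using assms by auto
  define c where "c = cis (pi / of_int (\<alpha> j - \<beta> j))"
  define u :: "complex^'n" where "u = (\<chi> i. if i = j then c else 1)"
  have "monom \<gamma> u = c powi \<gamma> j" for \<gamma>
    unfolding monom_def by (subst prod.remove[of _ j]) (auto simp: u_def)
  moreover have "c powi \<alpha> j = - (c powi \<beta> j)"
  proof -
    have "c powi (\<alpha> j - \<beta> j) = -1"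
      using j by (simp add: c_def cis_power_int)
    then show ?thesis
      by (simp add: power_int_diff c_def divide_eq_minus_1_iff)
  qed
  ultimately have "monom \<alpha> u = - monom \<beta> u" by simp
  moreover have "u \<in> unit_torus" by (simp add: unit_torus_def u_def c_def)
  ultimately show ?thesis by (rule that[rotated])
qed

lemma borel_measurable_monom [measurable]:
  fixes \<alpha> :: "'n::finite \<Rightarrow> int"
  shows "monom \<alpha> \<in> borel_measurable borel"
proof -
  have [measurable]: "(\<lambda>z::complex^'n. z$j) \<in> borel_measurable borel" for j
    by (intro borel_measurable_continuous_onI continuous_intros)
  have [measurable]: "(\<lambda>z::complex^'n. z$j powi k) \<in> borel_measurable borel" for j k
    by (cases "0 \<le> k") (simp_all add: power_int_def)
  show ?thesis unfolding monom_def by measurable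
qed

lemma monom_orthogonal:
  assumes inv: "torus_invariant M"
    and [measurable]: "monom \<alpha> \<in> borel_measurable M" "monom \<beta> \<in> borel_measurable M"
    and "\<alpha> \<noteq> \<beta>"
  shows "(\<integral>z. monom \<beta> z * duality_map p (monom \<alpha> z) \<partial>M) = 0"
proof -
  obtain u where u: "u \<in> unit_torus" "monom \<beta> u = - monom \<alpha> u"
    using monom_opposite_on_unit_torus \<open>\<alpha> \<noteq> \<beta>\<close> by metis
  have "monom \<beta> u * cnj (monom \<alpha> u) = -1"
    using u norm_monom_unit_torus[OF u(1), of \<alpha>] by (simp flip: complex_norm_square)
  moreover have "monom \<beta> (u * z) * duality_map p (monom \<alpha> (u * z))
      = (monom \<beta> u * cnj (monom \<alpha> u)) * (monom \<beta> z * duality_map p (monom \<alpha> z))" for z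
    by (simp add: monom_mult duality_map_mult_unimodular norm_monom_unit_torus[OF u(1)])
  ultimately have rotate: "monom \<beta> (u * z) * duality_map p (monom \<alpha> (u * z))
      = - (monom \<beta> z * duality_map p (monom \<alpha> z))" for z
    by simp
  have "(\<integral>z. monom \<beta> z * duality_map p (monom \<alpha> z) \<partial>M)
      = (\<integral>z. monom \<beta> z * duality_map p (monom \<alpha> z) \<partial>distr M M ((*) u))"
    using inv u(1) by (simp add: torus_invariant_def)
  also have "\<dots> = (\<integral>z. - (monom \<beta> z * duality_map p (monom \<alpha> z)) \<partial>M)"
    unfolding rotate[symmetric]
    by (rule integral_distr) (use inv u(1) in \<open>simp_all add: torus_invariant_def\<close>)
  finally show ?thesis by simp
qed

lemma reinhardt_mult_unit_torus:
  assumes "reinhardt \<Omega>" "u \<in> unit_torus" "z \<in> \<Omega>"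
  shows "u * z \<in> \<Omega>"
proof -
  have "exp (\<i> * of_real (Arg (u$j))) = u$j" for j
  proof -
    have "norm (u$j) = 1" using assms(2) by (simp add: unit_torus_def)
    then show ?thesis using Arg_eq[of "u$j"] by fastforce
  qed
  then have "u * z = (\<chi> j. exp (\<i> * of_real (Arg (u$j))) * z$j)"
    by (simp add: vec_eq_iff)
  then show ?thesis using assms by (simp add: reinhardt_def)
qed

lemma reinhardt_mult_unit_torus_iff:
  assumes "reinhardt \<Omega>" "u \<in> unit_torus"
  shows "u * z \<in> \<Omega> \<longleftrightarrow> z \<in> \<Omega>"
  using reinhardt_mult_unit_torus[OF assms(1)] unit_torus_inverse[OF assms(2)] assms(2) by metis

lemma torus_invariant_wmeasure:
  fixes \<Omega> :: "(complex^'n::finite) set"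
  assumes "reinhardt \<Omega>" "multi_radial \<Omega> wt" "(\<lambda>z. wt z * indicator \<Omega> z) \<in> borel_measurable lebesgue"
  shows "torus_invariant (wmeasure \<Omega> wt)"
  unfolding wmeasure_def
proof (rule torus_invariant_density[OF assms(3)])
  fix u z :: "complex^'n" assume u: "u \<in> unit_torus"
  have "norm ((u * z)$j) = norm (z$j)" for j
    using u by (simp add: unit_torus_def norm_mult)
  then have "wt (u * z) = wt z" if "z \<in> \<Omega>"
    using assms(2) that reinhardt_mult_unit_torus[OF assms(1) u that] unfolding multi_radial_def by blast
  then show "wt (u * z) * indicator \<Omega> (u * z) = wt z * indicator \<Omega> z"
    by (simp add: indicator_def reinhardt_mult_unit_torus_iff[OF assms(1) u])
qed

section \<open>Closed polydiscs\<close>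

definition cpolydisc :: "complex^'n \<Rightarrow> real \<Rightarrow> (complex^'n) set" where
  "cpolydisc a r = {z. \<forall>j. z$j \<in> cball (a$j) r}"

lemma cpolydisc_subset_cball:
  fixes a :: "complex^'n"
  shows "cpolydisc a r \<subseteq> cball a (real CARD('n) * r)"
proof
  fix z assume z: "z \<in> cpolydisc a r"
  have "dist a z \<le> (\<Sum>j\<in>UNIV. dist (a$j) (z$j))"
    unfolding dist_vec_def by (rule L2_set_le_sum) simp
  also have "\<dots> \<le> (\<Sum>j\<in>(UNIV::'n set). r)"
    using z by (intro sum_mono) (auto simp: cpolydisc_def)
  finally show "z \<in> cball a (real CARD('n) * r)" by simp
qed

lemma compact_cpolydisc: "compact (cpolydisc a r)"
proof -
  have "closed (cpolydisc a r)"
    unfolding cpolydisc_def mem_cball by (intro closed_Collect_all closed_Collect_le continuous_intros)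
  moreover have "bounded (cpolydisc a r)"
    by (rule bounded_subset[OF bounded_cball cpolydisc_subset_cball])
  ultimately show ?thesis by (simp add: compact_eq_bounded_closed)
qed

lemma open_contains_cpolydisc:
  fixes a :: "complex^'n"
  assumes "open \<Omega>" "a \<in> \<Omega>"
  obtains r where "0 < r" "cpolydisc a r \<subseteq> \<Omega>"
proof -
  obtain e where "0 < e" "cball a e \<subseteq> \<Omega>"
    using assms open_contains_cball by blast
  then show ?thesis
    using cpolydisc_subset_cball[of a "e / real CARD('n)"] by (intro that[of "e / real CARD('n)"]) auto
qed

lemma open_contains_nonzero_coordinates:
  fixes \<Omega> :: "(complex^'n) set"
  assumes "open \<Omega>" "\<Omega> \<noteq> {}"
  obtains a where "a \<in> \<Omega>" "\<And>j. a$j \<noteq> 0"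
proof -
  obtain a where "a \<in> \<Omega>" using assms by auto
  then obtain r where r: "0 < r" "cpolydisc a r \<subseteq> \<Omega>"
    using open_contains_cpolydisc assms by blast
  define b :: "complex^'n" where "b = (\<chi> j. if a$j = 0 then of_real r else a$j)"
  have "b \<in> cpolydisc a r" using r(1) by (simp add: b_def cpolydisc_def)
  with r show ?thesis by (intro that[of b]) (auto simp: b_def)
qed

section \<open>Uniqueness of Laurent expansions\<close>

text \<open>Averaging a vanishing series over \<open>u\<close> and \<open>v * u\<close> multiplies its coefficients by factors of
  modulus at most 1, equal to 1 at \<open>\<beta>\<close> and to 0 wherever \<open>monom \<alpha> v = - monom \<beta> v\<close>.\<close>
lemma has_sum_monom_unit_torus_average:
  fixes c :: "('n::finite \<Rightarrow> int) \<Rightarrow> complex"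
  assumes sum: "\<And>u. u \<in> unit_torus \<Longrightarrow> ((\<lambda>\<alpha>. c \<alpha> * monom \<alpha> u) has_sum 0) UNIV"
    and u: "u \<in> unit_torus" and v: "v \<in> unit_torus"
  shows "((\<lambda>\<alpha>. c \<alpha> * ((1 + monom \<alpha> v / monom \<beta> v) / 2) * monom \<alpha> u) has_sum 0) UNIV"
proof -
  have "((\<lambda>\<alpha>. (c \<alpha> * monom \<alpha> u + c \<alpha> * monom \<alpha> (v * u) * inverse (monom \<beta> v)) * (1/2))
      has_sum (0 + 0 * inverse (monom \<beta> v)) * (1/2)) UNIV"
    by (intro has_sum_cmult_left has_sum_add sum u mult_in_unit_torus v)
  moreover have "(c \<alpha> * monom \<alpha> u + c \<alpha> * monom \<alpha> (v * u) * inverse (monom \<beta> v)) * (1/2)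
      = c \<alpha> * ((1 + monom \<alpha> v / monom \<beta> v) / 2) * monom \<alpha> u" for \<alpha>
    unfolding monom_mult divide_inverse by algebra
  ultimately show ?thesis by (simp only: mult_zero_left add_0_left)
qed

lemma has_sum_monom_unit_torus_annihilate:
  fixes c :: "('n::finite \<Rightarrow> int) \<Rightarrow> complex"
  assumes "\<And>u. u \<in> unit_torus \<Longrightarrow> ((\<lambda>\<alpha>. c \<alpha> * monom \<alpha> u) has_sum 0) UNIV"
    and "finite F" "\<beta> \<notin> F"
  obtains d where "\<And>u. u \<in> unit_torus \<Longrightarrow> ((\<lambda>\<alpha>. d \<alpha> * monom \<alpha> u) has_sum 0) UNIV"
    "d \<beta> = c \<beta>" "\<And>\<alpha>. \<alpha> \<in> F \<Longrightarrow> d \<alpha> = 0" "\<And>\<alpha>. norm (d \<alpha>) \<le> norm (c \<alpha>)"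
  using assms(2,3)
proof (induction F arbitrary: thesis rule: finite_induct)
  case empty
  show ?case by (rule empty(1)[of c]) (use assms(1) in auto)
next
  case (insert \<gamma> F)
  obtain d where d: "\<And>u. u \<in> unit_torus \<Longrightarrow> ((\<lambda>\<alpha>. d \<alpha> * monom \<alpha> u) has_sum 0) UNIV"
    "d \<beta> = c \<beta>" "\<And>\<alpha>. \<alpha> \<in> F \<Longrightarrow> d \<alpha> = 0" "\<And>\<alpha>. norm (d \<alpha>) \<le> norm (c \<alpha>)"
    using insert.IH insert.prems(2) by blast
  obtain v where v: "v \<in> unit_torus" "monom \<gamma> v = - monom \<beta> v"
    using monom_opposite_on_unit_torus[of \<gamma> \<beta>] insert.prems(2) by blast
  then have "monom \<beta> v \<noteq> 0"
    using norm_monom_unit_torus[of v \<beta>] by auto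
  show ?case
  proof (rule insert.prems(1)[of "\<lambda>\<alpha>. d \<alpha> * ((1 + monom \<alpha> v / monom \<beta> v) / 2)"])
    show "d \<alpha> * ((1 + monom \<alpha> v / monom \<beta> v) / 2) = 0" if "\<alpha> \<in> insert \<gamma> F" for \<alpha>
      using that d(3) v(2) \<open>monom \<beta> v \<noteq> 0\<close> by auto
    show "norm (d \<alpha> * ((1 + monom \<alpha> v / monom \<beta> v) / 2)) \<le> norm (c \<alpha>)" for \<alpha>
    proof -
      have "norm (1 + monom \<alpha> v / monom \<beta> v) \<le> 2"
        using norm_triangle_ineq[of 1 "monom \<alpha> v / monom \<beta> v"]
        by (simp add: norm_divide norm_monom_unit_torus[OF v(1)])
      then have "norm (d \<alpha>) * norm ((1 + monom \<alpha> v / monom \<beta> v) / 2) \<le> norm (c \<alpha>) * 1"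
        by (intro mult_mono d(4)) (auto simp: norm_divide)
      then show ?thesis by (simp add: norm_mult)
    qed
  qed (use d(2) \<open>monom \<beta> v \<noteq> 0\<close> has_sum_monom_unit_torus_average[OF d(1) _ v(1)] in auto)
qed

lemma has_sum_monom_unit_torus_tail_bound:
  fixes c :: "('n::finite \<Rightarrow> int) \<Rightarrow> complex"
  assumes sum: "\<And>u. u \<in> unit_torus \<Longrightarrow> ((\<lambda>\<alpha>. c \<alpha> * monom \<alpha> u) has_sum 0) UNIV"
    and abs: "(\<lambda>\<alpha>. norm (c \<alpha>)) summable_on UNIV" and F: "finite F" "\<beta> \<notin> F"
  shows "norm (c \<beta>) \<le> (\<Sum>\<^sub>\<infinity>\<alpha>\<in>- insert \<beta> F. norm (c \<alpha>))"
proof -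
  define G where "G = - insert \<beta> F"
  obtain d where d: "\<And>u. u \<in> unit_torus \<Longrightarrow> ((\<lambda>\<alpha>. d \<alpha> * monom \<alpha> u) has_sum 0) UNIV"
    "d \<beta> = c \<beta>" "\<And>\<alpha>. \<alpha> \<in> F \<Longrightarrow> d \<alpha> = 0" "\<And>\<alpha>. norm (d \<alpha>) \<le> norm (c \<alpha>)"
    using has_sum_monom_unit_torus_annihilate[OF sum F] by blast
  have abs_c: "(\<lambda>\<alpha>. norm (c \<alpha>)) summable_on G"
    by (rule summable_on_subset_banach[OF abs]) simp
  have abs_d: "(\<lambda>\<alpha>. norm (d \<alpha>)) summable_on G"
    by (rule summable_on_comparison_test[OF abs_c]) (use d(4) in auto)
  have "0 = infsum d UNIV"
    using infsumI[OF d(1)[OF one_in_unit_torus]] by (simp add: monom_one)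
  also have "\<dots> = infsum d (insert \<beta> G)"
    by (rule infsum_cong_neutral) (use d(3) in \<open>auto simp: G_def\<close>)
  also have "\<dots> = c \<beta> + infsum d G"
    using abs_summable_summable[OF abs_d] by (simp add: infsum_insert G_def d(2))
  finally have "norm (c \<beta>) = norm (infsum d G)"
    by (metis add_eq_0_iff norm_minus_cancel)
  also have "\<dots> \<le> (\<Sum>\<^sub>\<infinity>\<alpha>\<in>G. norm (d \<alpha>))"
    by (rule norm_infsum_bound[OF abs_d])
  also have "\<dots> \<le> (\<Sum>\<^sub>\<infinity>\<alpha>\<in>G. norm (c \<alpha>))"
    by (intro infsum_mono abs_d abs_c d(4))
  finally show ?thesis by (simp add: G_def)
qed

lemma has_sum_monom_unit_torus_imp_zero:
  fixes c :: "('n::finite \<Rightarrow> int) \<Rightarrow> complex"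
  assumes sum: "\<And>u. u \<in> unit_torus \<Longrightarrow> ((\<lambda>\<alpha>. c \<alpha> * monom \<alpha> u) has_sum 0) UNIV"
  shows "c \<beta> = 0"
proof -
  let ?S = "\<Sum>\<^sub>\<infinity>\<alpha>\<in>- {\<beta>}. norm (c \<alpha>)"
  have "c summable_on UNIV"
    using has_sum_imp_summable[OF sum[OF one_in_unit_torus]] by (simp add: monom_one)
  then have abs: "(\<lambda>\<alpha>. norm (c \<alpha>)) summable_on A" for A
    unfolding summable_on_iff_abs_summable_on_complex by (rule summable_on_subset_banach) simp
  have "(\<Sum>\<alpha>\<in>F. norm (c \<alpha>)) \<le> ?S - norm (c \<beta>)" if F: "finite F" "F \<subseteq> - {\<beta>}" for F
  proof -
    have "norm (c \<beta>) + (\<Sum>\<alpha>\<in>F. norm (c \<alpha>))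
        \<le> (\<Sum>\<^sub>\<infinity>\<alpha>\<in>- insert \<beta> F. norm (c \<alpha>)) + (\<Sum>\<^sub>\<infinity>\<alpha>\<in>F. norm (c \<alpha>))"
      using has_sum_monom_unit_torus_tail_bound[OF sum abs F(1)] F by auto
    also have "\<dots> = (\<Sum>\<^sub>\<infinity>\<alpha>\<in>- insert \<beta> F \<union> F. norm (c \<alpha>))"
      by (rule infsum_Un_disjoint[symmetric]) (auto simp: abs)
    also have "- insert \<beta> F \<union> F = - {\<beta>}" using F(2) by auto
    finally show ?thesis by simp
  qed
  then have "?S \<le> ?S - norm (c \<beta>)"
    by (intro infsum_le_finite_sums abs)
  then show ?thesis by simp
qed

lemma laurent_series_unique:
  fixes \<Omega> :: "(complex^'n::finite) set"
  assumes "open \<Omega>" "\<Omega> \<noteq> {}" "reinhardt \<Omega>" "laurent_series \<Omega> f c" "laurent_series \<Omega> f d"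
  shows "c = d"
proof
  fix \<beta> :: "'n \<Rightarrow> int"
  obtain a where a: "a \<in> \<Omega>" "\<And>j. a$j \<noteq> 0"
    using open_contains_nonzero_coordinates assms(1,2) by blast
  have "(c \<beta> - d \<beta>) * monom \<beta> a = 0"
  proof (rule has_sum_monom_unit_torus_imp_zero)
    fix u :: "complex^'n" assume "u \<in> unit_torus"
    then have "u * a \<in> \<Omega>" using assms(3) a(1) reinhardt_mult_unit_torus by blast
    then have "((\<lambda>\<alpha>. c \<alpha> * monom \<alpha> (u * a) + - (d \<alpha> * monom \<alpha> (u * a)))
        has_sum f (u * a) + - f (u * a)) UNIV"
      using assms(4,5) by (intro has_sum_add) (auto simp: laurent_series_def has_sum_uminus)
    then show "((\<lambda>\<alpha>. (c \<alpha> - d \<alpha>) * monom \<alpha> a * monom \<alpha> u) has_sum 0) UNIV"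
      by (simp add: monom_mult algebra_simps)
  qed
  then show "c \<beta> = d \<beta>" using a(2) by (simp add: monom_def)
qed

section \<open>Local bounds for monomials\<close>

lemma cball_contains_norm:
  fixes a :: complex
  assumes "0 \<le> s" "\<bar>norm a - s\<bar> \<le> r"
  obtains t where "t \<in> cball a r" "norm t = s"
proof (cases "a = 0")
  case True
  with assms show ?thesis by (intro that[of "of_real s"]) auto
next
  case False
  have "a = of_real (norm a) * sgn a"
    using False by (simp add: sgn_eq)
  then have "a - of_real s * sgn a = of_real (norm a - s) * sgn a"
    by (simp add: left_diff_distrib)
  then have "dist a (of_real s * sgn a) = \<bar>norm a - s\<bar>"
    using False by (simp add: dist_norm norm_mult norm_sgn del: of_real_diff)
  with False assms show ?thesis
    by (intro that[of "of_real s * sgn a"]) (auto simp: norm_mult norm_sgn)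
qed

lemma powi_le_geometric:
  fixes x y \<rho> :: real
  assumes "0 \<le> x" "0 \<le> \<rho>" and "0 \<le> k \<Longrightarrow> x \<le> \<rho> * y" and "k < 0 \<Longrightarrow> 0 < y \<and> y \<le> \<rho> * x"
  shows "x powi k \<le> \<rho> ^ nat \<bar>k\<bar> * y powi k"
proof (cases "0 \<le> k")
  case True
  then show ?thesis
    using power_mono[OF assms(3) assms(1), of "nat k"] by (simp add: power_int_def power_mult_distrib)
next
  case False
  define n where "n = nat (- k)"
  have "0 < y" "y \<le> \<rho> * x" using assms(4) False by auto
  then have "0 < x" using assms(1) by (metis mult_zero_right not_le order_le_less)
  have "y ^ n \<le> \<rho> ^ n * x ^ n"
    using power_mono[of y "\<rho> * x" n] \<open>0 < y\<close> \<open>y \<le> \<rho> * x\<close> by (simp add: power_mult_distrib)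
  then have "inverse (x ^ n) \<le> \<rho> ^ n * inverse (y ^ n)"
    using \<open>0 < x\<close> \<open>0 < y\<close> by (simp add: field_simps)
  then show ?thesis
    using False by (simp add: power_int_def n_def power_inverse)
qed

lemma norm_locally_dominated_outer:
  fixes a :: complex
  assumes "0 < r"
  obtains \<rho> t where "0 \<le> \<rho>" "\<rho> < 1" "t \<in> cball a r" "\<forall>\<^sub>F z in nhds a. norm z \<le> \<rho> * norm t"
proof -
  obtain t where t: "t \<in> cball a r" "norm t = norm a + r"
    by (rule cball_contains_norm[of "norm a + r" a r]) (use assms in auto)
  have "0 < norm t" using assms by (simp add: t(2) add_nonneg_pos)
  then have "norm a / norm t < 1" using assms by (simp add: t(2))
  then obtain \<rho> where \<rho>: "norm a / norm t < \<rho>" "\<rho> < 1"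
    using dense by blast
  have "norm a < \<rho> * norm t"
    using \<rho>(1) \<open>0 < norm t\<close> by (simp only: pos_divide_less_eq)
  then have "\<forall>\<^sub>F z in nhds a. norm z < \<rho> * norm t"
    by (rule order_tendstoD(2)[OF tendsto_norm[OF filterlim_ident]])
  moreover have "0 \<le> \<rho>"
    by (rule order_trans[OF _ less_imp_le[OF \<rho>(1)]]) simp
  ultimately show ?thesis
    using \<rho>(2) t(1) by (intro that[of \<rho> t]) (auto elim: eventually_mono)
qed

lemma norm_locally_dominated_inner:
  fixes a :: complex
  assumes "0 < r" "a \<noteq> 0"
  obtains \<rho> t where "0 \<le> \<rho>" "\<rho> < 1" "t \<in> cball a r" "t \<noteq> 0" "\<forall>\<^sub>F z in nhds a. norm t \<le> \<rho> * norm z"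
proof -
  define d where "d = min r (norm a / 2)"
  have d: "0 < d" "d \<le> r" "d < norm a"
    using assms by (auto simp: d_def min_less_iff_disj)
  obtain t where t: "t \<in> cball a r" "norm t = norm a - d"
    by (rule cball_contains_norm[of "norm a - d" a r]) (use d in auto)
  have "norm t / norm a < 1" using d assms by (simp add: t(2))
  then obtain \<rho> where \<rho>: "norm t / norm a < \<rho>" "\<rho> < 1"
    using dense by blast
  have "((\<lambda>z. \<rho> * norm z) \<longlongrightarrow> \<rho> * norm a) (nhds a)"
    by (intro tendsto_intros filterlim_ident)
  moreover have "norm t < \<rho> * norm a"
    using \<rho>(1) assms by (simp add: pos_divide_less_eq)
  ultimately have "\<forall>\<^sub>F z in nhds a. norm t < \<rho> * norm z"
    by (rule order_tendstoD(1))
  moreover have "0 \<le> \<rho>"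
    by (rule order_trans[OF _ less_imp_le[OF \<rho>(1)]]) simp
  moreover have "t \<noteq> 0" using d(3) t(2) by auto
  ultimately show ?thesis
    using \<rho>(2) t(1) by (intro that[of \<rho> t]) (auto elim: eventually_mono)
qed

lemma powi_locally_dominated:
  fixes a :: complex
  assumes "0 < r"
  obtains \<rho> where "0 \<le> \<rho>" "\<rho> < 1"
    "\<forall>\<^sub>F z in nhds a. \<forall>k. a \<noteq> 0 \<or> 0 \<le> k \<longrightarrow>
       (\<exists>t\<in>cball a r. norm z powi k \<le> \<rho> ^ nat \<bar>k\<bar> * norm t powi k)"
proof -
  obtain \<rho> t where \<rho>: "0 \<le> \<rho>" "\<rho> < 1" and t: "t \<in> cball a r" "\<forall>\<^sub>F z in nhds a. norm z \<le> \<rho> * norm t"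
    using norm_locally_dominated_outer[OF assms] by blast
  show ?thesis
  proof (cases "a = 0")
    case True
    show ?thesis
    proof (rule that[OF \<rho>], use t(2) in eventually_elim)
      case (elim z)
      have "norm z powi k \<le> \<rho> ^ nat \<bar>k\<bar> * norm t powi k" if "0 \<le> k" for k
        by (rule powi_le_geometric) (use that elim \<rho>(1) in auto)
      then show ?case using True t(1) by blast
    qed
  next
    case False
    obtain \<sigma> s where \<sigma>: "0 \<le> \<sigma>" "\<sigma> < 1"
      and s: "s \<in> cball a r" "s \<noteq> 0" "\<forall>\<^sub>F z in nhds a. norm s \<le> \<sigma> * norm z"
      using norm_locally_dominated_inner[OF assms False] by blast
    have "0 \<le> max \<rho> \<sigma>" "max \<rho> \<sigma> < 1"
      using \<rho> \<sigma> by auto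
    then show ?thesis
    proof (rule that, use t(2) s(3) in eventually_elim)
      case (elim z)
      have "norm z \<le> max \<rho> \<sigma> * norm t" "norm s \<le> max \<rho> \<sigma> * norm z"
        by (rule order_trans[OF elim(1)] order_trans[OF elim(2)], simp add: mult_right_mono)+
      then have "norm z powi k \<le> max \<rho> \<sigma> ^ nat \<bar>k\<bar> * norm (if 0 \<le> k then t else s) powi k" for k
        using \<rho>(1) s(2) by (intro powi_le_geometric) (auto simp: le_max_iff_disj)
      moreover have "(if 0 \<le> k then t else s) \<in> cball a r" for k :: int
        using s(1) t(1) by simp
      ultimately show ?case by blast
    qed
  qed
qed

lemma monom_locally_dominated:
  fixes a :: "complex^'n::finite"
  assumes "0 < r"
  obtains \<rho> :: "'n \<Rightarrow> real" where "\<And>j. 0 \<le> \<rho> j" "\<And>j. \<rho> j < 1"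
    "\<forall>\<^sub>F z in nhds a. \<forall>\<alpha>. (\<forall>j. a$j = 0 \<longrightarrow> 0 \<le> \<alpha> j) \<longrightarrow>
       (\<exists>t\<in>cpolydisc a r. norm (monom \<alpha> z) \<le> (\<Prod>j\<in>UNIV. \<rho> j ^ nat \<bar>\<alpha> j\<bar>) * norm (monom \<alpha> t))"
proof -
  define dominated where "dominated \<rho> j z \<longleftrightarrow> (\<forall>k. a$j \<noteq> 0 \<or> 0 \<le> k \<longrightarrow>
    (\<exists>t\<in>cball (a$j) r. norm z powi k \<le> \<rho> ^ nat \<bar>k\<bar> * norm t powi k))"
    for \<rho> j and z :: complex
  have "\<exists>\<rho>. 0 \<le> \<rho> \<and> \<rho> < 1 \<and> eventually (dominated \<rho> j) (nhds (a$j))" for j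
    by (rule powi_locally_dominated[OF assms, of "a$j"]) (auto simp: dominated_def[abs_def])
  then obtain \<rho> where \<rho>: "0 \<le> \<rho> j" "\<rho> j < 1" and "eventually (dominated (\<rho> j) j) (nhds (a$j))" for j
    by metis
  moreover have "filterlim (\<lambda>z. z$j) (nhds (a$j)) (nhds a)" for j
    by (rule tendsto_vec_nth[OF filterlim_ident])
  ultimately have "\<forall>\<^sub>F z in nhds a. \<forall>j. dominated (\<rho> j) j (z$j)"
    by (intro eventually_all_finite) (rule eventually_compose_filterlim)
  then have "\<forall>\<^sub>F z in nhds a. \<forall>\<alpha>. (\<forall>j. a$j = 0 \<longrightarrow> 0 \<le> \<alpha> j) \<longrightarrow>
       (\<exists>t\<in>cpolydisc a r. norm (monom \<alpha> z) \<le> (\<Prod>j\<in>UNIV. \<rho> j ^ nat \<bar>\<alpha> j\<bar>) * norm (monom \<alpha> t))"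
  proof eventually_elim
    case (elim z)
    show ?case
    proof (intro allI impI)
      fix \<alpha> :: "'n \<Rightarrow> int" assume "\<forall>j. a$j = 0 \<longrightarrow> 0 \<le> \<alpha> j"
      then have "\<forall>j. \<exists>t. t \<in> cball (a$j) r \<and> norm (z$j) powi \<alpha> j \<le> \<rho> j ^ nat \<bar>\<alpha> j\<bar> * norm t powi \<alpha> j"
        using elim unfolding dominated_def by blast
      then obtain t where t: "t j \<in> cball (a$j) r"
        "norm (z$j) powi \<alpha> j \<le> \<rho> j ^ nat \<bar>\<alpha> j\<bar> * norm (t j) powi \<alpha> j" for j
        by metis
      have "norm (monom \<alpha> z) \<le> (\<Prod>j\<in>UNIV. \<rho> j ^ nat \<bar>\<alpha> j\<bar> * norm (t j) powi \<alpha> j)"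
        unfolding norm_monom by (intro prod_mono conjI t(2) zero_le_power_int norm_ge_zero)
      also have "\<dots> = (\<Prod>j\<in>UNIV. \<rho> j ^ nat \<bar>\<alpha> j\<bar>) * norm (monom \<alpha> (\<chi> j. t j))"
        by (simp add: norm_monom prod.distrib)
      finally show "\<exists>t\<in>cpolydisc a r. norm (monom \<alpha> z) \<le> (\<Prod>j\<in>UNIV. \<rho> j ^ nat \<bar>\<alpha> j\<bar>) * norm (monom \<alpha> t)"
        using t(1) by (intro bexI[of _ "\<chi> j. t j"]) (auto simp: cpolydisc_def)
    qed
  qed
  then show ?thesis by (rule that[OF \<rho>])
qed

lemma monom_bounded_imp_exponent_nonneg:
  assumes "0 < r" and bound: "\<And>z. z \<in> cpolydisc a r \<Longrightarrow> norm (monom \<alpha> z) \<le> B" and "a$j = 0"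
  shows "0 \<le> \<alpha> j"
proof (rule ccontr)
  assume "\<not> 0 \<le> \<alpha> j"
  define b where "b i = (if a$i = 0 then of_real r else a$i)" for i
  define Q where "Q = (\<Prod>i\<in>UNIV - {j}. norm (b i) powi \<alpha> i)"
  have "0 < Q"
    unfolding Q_def using \<open>0 < r\<close> by (intro prod_pos) (auto simp: b_def)
  define w where "w s = (\<chi> i. if i = j then of_real s else b i)" for s
  have monom_w: "norm (monom \<alpha> (w s)) = inverse s ^ nat (- \<alpha> j) * Q" if "0 < s" for s
    unfolding norm_monom Q_def using that \<open>\<not> 0 \<le> \<alpha> j\<close>
    by (subst prod.remove[of _ j]) (auto simp: w_def power_int_def intro!: prod.cong)
  have "filterlim (\<lambda>s. inverse s ^ nat (- \<alpha> j) * Q) at_top (at_right 0)"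
    using \<open>0 < Q\<close> \<open>\<not> 0 \<le> \<alpha> j\<close>
    by (intro filterlim_at_top_mult_tendsto_pos[OF tendsto_const] filterlim_pow_at_top
        filterlim_inverse_at_top_right) auto
  then have "\<forall>\<^sub>F s in at_right 0. B < inverse s ^ nat (- \<alpha> j) * Q"
    by (simp add: filterlim_at_top_dense)
  moreover have "\<forall>\<^sub>F s in at_right 0. 0 < s \<and> s \<le> r"
    using \<open>0 < r\<close> by (auto simp: eventually_at_right_field intro: exI[of _ r])
  ultimately obtain s where "B < inverse s ^ nat (- \<alpha> j) * Q" "0 < s" "s \<le> r"
    using eventually_happens[OF eventually_conj] by force
  moreover have "w s \<in> cpolydisc a r"
    using \<open>a$j = 0\<close> \<open>0 < s\<close> \<open>s \<le> r\<close> by (auto simp: cpolydisc_def w_def b_def)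
  ultimately show False using bound[of "w s"] by (simp add: monom_w)
qed

section \<open>Summable families indexed by exponents\<close>

lemma summable_on_geometric_int:
  fixes \<rho> :: real
  assumes "0 \<le> \<rho>" "\<rho> < 1"
  shows "(\<lambda>k::int. \<rho> ^ nat \<bar>k\<bar>) summable_on UNIV"
proof -
  have geometric: "(\<lambda>n. \<rho> ^ n) summable_on N" for N
    by (rule summable_on_subset_banach[OF summable_on_UNIV_nonneg_real_iff[THEN iffD2]])
      (use assms in auto)
  have "(\<lambda>k. \<rho> ^ nat \<bar>k\<bar>) summable_on int ` UNIV"
    using geometric[of UNIV] by (subst summable_on_reindex) (auto simp: o_def)
  moreover have "(\<lambda>k. \<rho> ^ nat \<bar>k\<bar>) summable_on (\<lambda>n. - int n) ` {0<..}"
    using geometric[of "{0<..}"] by (subst summable_on_reindex) (auto simp: o_def inj_on_def)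
  ultimately have "(\<lambda>k. \<rho> ^ nat \<bar>k\<bar>) summable_on (int ` UNIV \<union> (\<lambda>n. - int n) ` {0<..})"
    by (rule summable_on_Un_disjoint) auto
  moreover have "k \<in> int ` UNIV \<union> (\<lambda>n. - int n) ` {0<..}" for k
    by (cases k) (auto intro!: image_eqI[of _ _ "Suc _"])
  then have "int ` UNIV \<union> (\<lambda>n. - int n) ` {0<..} = UNIV" by blast
  ultimately show ?thesis by simp
qed

lemma summable_on_prod_geometric_int:
  fixes \<rho> :: "'n::finite \<Rightarrow> real"
  assumes "\<And>j. 0 \<le> \<rho> j" "\<And>j. \<rho> j < 1"
  shows "(\<lambda>\<alpha>::'n \<Rightarrow> int. \<Prod>j\<in>UNIV. \<rho> j ^ nat \<bar>\<alpha> j\<bar>) summable_on UNIV"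
proof -
  have "(\<lambda>k::int. norm (\<rho> j ^ nat \<bar>k\<bar>)) summable_on UNIV" for j
    using summable_on_geometric_int[OF assms, of j] assms(1)[of j] by simp
  then have "Infinite_Set_Sum.abs_summable_on (\<lambda>k::int. \<rho> j ^ nat \<bar>k\<bar>) UNIV" for j
    by (rule abs_summable_equivalent[THEN iffD1])
  then have "Infinite_Set_Sum.abs_summable_on (\<lambda>\<alpha>::'n \<Rightarrow> int. \<Prod>j\<in>UNIV. \<rho> j ^ nat \<bar>\<alpha> j\<bar>)
      (\<Pi>\<^sub>E j\<in>UNIV. UNIV)"
    by (intro abs_summable_on_prod_PiE) auto
  then have "Infinite_Set_Sum.abs_summable_on (\<lambda>\<alpha>::'n \<Rightarrow> int. \<Prod>j\<in>UNIV. \<rho> j ^ nat \<bar>\<alpha> j\<bar>) UNIV"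
    by simp
  then show ?thesis
    by (rule abs_summable_summable[OF abs_summable_equivalent[THEN iffD2]])
qed

lemma compact_locally_summable_majorant:
  fixes u :: "'i \<Rightarrow> 'a::topological_space \<Rightarrow> real"
  assumes "compact K" and nonneg: "\<And>i z. i \<in> I \<Longrightarrow> 0 \<le> u i z"
    and "\<And>a. a \<in> K \<Longrightarrow> \<exists>h. h summable_on I \<and> (\<forall>\<^sub>F z in nhds a. \<forall>i\<in>I. u i z \<le> h i)"
  obtains h where "h summable_on I" "\<And>i z. i \<in> I \<Longrightarrow> z \<in> K \<Longrightarrow> u i z \<le> h i"
proof -
  have "\<forall>a\<in>K. \<exists>U h. open U \<and> a \<in> U \<and> h summable_on I \<and> (\<forall>z\<in>U. \<forall>i\<in>I. u i z \<le> h i)"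
  proof
    fix a assume "a \<in> K"
    then obtain h where "h summable_on I" "\<forall>\<^sub>F z in nhds a. \<forall>i\<in>I. u i z \<le> h i"
      using assms(3) by blast
    then show "\<exists>U h. open U \<and> a \<in> U \<and> h summable_on I \<and> (\<forall>z\<in>U. \<forall>i\<in>I. u i z \<le> h i)"
      unfolding eventually_nhds by blast
  qed
  then obtain U h where "\<forall>a\<in>K. open (U a) \<and> a \<in> U a \<and> h a summable_on I
      \<and> (\<forall>z\<in>U a. \<forall>i\<in>I. u i z \<le> h a i)"
    unfolding bchoice_iff by blast
  then have U: "open (U a)" "a \<in> U a" and h: "h a summable_on I"
    and bound: "z \<in> U a \<Longrightarrow> i \<in> I \<Longrightarrow> u i z \<le> h a i" if "a \<in> K" for a z i
    using that by simp_all
  obtain A where A: "A \<subseteq> K" "finite A" "K \<subseteq> (\<Union>a\<in>A. U a)"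
    by (rule compactE_image[OF \<open>compact K\<close>, of K U]) (use U in auto)
  show ?thesis
  proof (rule that)
    show "(\<lambda>i. \<Sum>a\<in>A. h a i) summable_on I"
      using A(2,1) h by (induction A rule: finite_induct) (auto intro: summable_on_add)
    fix i z assume "i \<in> I" "z \<in> K"
    then obtain a where a: "a \<in> A" "z \<in> U a" using A by blast
    have "u i z \<le> h a i" using bound a A(1) \<open>i \<in> I\<close> by blast
    also have "\<dots> \<le> (\<Sum>a\<in>A. h a i)"
    proof (rule member_le_sum[OF a(1) _ A(2)])
      fix b assume "b \<in> A - {a}"
      then show "0 \<le> h b i"
        using bound[of b b i] U(2)[of b] A(1) \<open>i \<in> I\<close> nonneg[of i b] by force
    qed
    finally show "u i z \<le> (\<Sum>a\<in>A. h a i)" .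
  qed
qed

lemma supnorm_le_iff: "supnorm \<alpha> \<le> int N \<longleftrightarrow> (\<forall>j. \<bar>\<alpha> j\<bar> \<le> int N)"
  unfolding supnorm_def by (subst Max_le_iff) auto

lemma finite_trunc_set: "finite (trunc_set \<Omega> wt p N)"
proof (rule finite_subset)
  show "trunc_set \<Omega> wt p N \<subseteq> (\<Pi>\<^sub>E j\<in>UNIV. {- int N..int N})"
    by (auto simp: trunc_set_def supnorm_le_iff abs_le_iff) (metis minus_le_iff)
qed (auto intro: finite_PiE)

lemma trunc_set_mono: "m \<le> n \<Longrightarrow> trunc_set \<Omega> wt p m \<subseteq> trunc_set \<Omega> wt p n"
  unfolding trunc_set_def by auto

lemma trunc_set_subset: "trunc_set \<Omega> wt p N \<subseteq> Sp_set \<Omega> wt p"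
  unfolding trunc_set_def by auto

lemma eventually_in_trunc_set:
  assumes "\<alpha> \<in> Sp_set \<Omega> wt p"
  shows "\<forall>\<^sub>F N in sequentially. \<alpha> \<in> trunc_set \<Omega> wt p N"
  using eventually_ge_at_top[of "nat (supnorm \<alpha>)"]
  by eventually_elim (use assms in \<open>simp add: trunc_set_def nat_le_iff\<close>)

lemma filterlim_trunc_set:
  "filterlim (trunc_set \<Omega> wt p) (finite_subsets_at_top (Sp_set \<Omega> wt p)) sequentially"
  unfolding filterlim_finite_subsets_at_top
proof (intro allI impI)
  fix X assume "finite X \<and> X \<subseteq> Sp_set \<Omega> wt p"
  then have "\<forall>\<^sub>F N in sequentially. \<forall>\<alpha>\<in>X. \<alpha> \<in> trunc_set \<Omega> wt p N"
    by (intro eventually_ball_finite) (auto intro: eventually_in_trunc_set)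
  then show "\<forall>\<^sub>F N in sequentially. finite (trunc_set \<Omega> wt p N) \<and> X \<subseteq> trunc_set \<Omega> wt p N
      \<and> trunc_set \<Omega> wt p N \<subseteq> Sp_set \<Omega> wt p"
    by eventually_elim (auto simp: finite_trunc_set trunc_set_subset[THEN subsetD])
qed

lemma has_sum_imp_tendsto_trunc_set:
  assumes "(f has_sum s) (Sp_set \<Omega> wt p)"
  shows "(\<lambda>N. \<Sum>\<alpha>\<in>trunc_set \<Omega> wt p N. f \<alpha>) \<longlonglongrightarrow> s"
  using filterlim_compose[OF assms[unfolded has_sum_def] filterlim_trunc_set] .

section \<open>Weighted spaces of holomorphic functions\<close>

lemma mem_Lp_space_iff: "f \<in> Lp_space \<Omega> wt p \<longleftrightarrow> p_integrable p (wmeasure \<Omega> wt) f"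
  by (auto simp: Lp_space_def p_integrable_def integrable_iff_bounded)

lemma Lpnorm_eq_p_norm:
  assumes "p_integrable p (wmeasure \<Omega> wt) f"
  shows "Lpnorm \<Omega> wt p f = p_norm p (wmeasure \<Omega> wt) f"
  using assms unfolding Lpnorm_def p_norm_def p_integrable_def
  by (subst integral_eq_nn_integral) auto

lemma holo_n_add:
  assumes "holo_n \<Omega> f" "holo_n \<Omega> g"
  shows "holo_n \<Omega> (\<lambda>z. f z + g z)"
  unfolding holo_n_def
proof
  fix z assume "z \<in> \<Omega>"
  then obtain L L' where "(f has_derivative L) (at z)" "\<forall>c v. L (c *s v) = c * L v"
      "(g has_derivative L') (at z)" "\<forall>c v. L' (c *s v) = c * L' v"
    using assms unfolding holo_n_def by meson
  then show "\<exists>L. ((\<lambda>z. f z + g z) has_derivative L) (at z) \<and> (\<forall>c v. L (c *s v) = c * L v)"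
    by (intro exI[of _ "\<lambda>v. L v + L' v"]) (auto intro: has_derivative_add simp: distrib_left)
qed

lemma holo_n_cmult:
  assumes "holo_n \<Omega> f"
  shows "holo_n \<Omega> (\<lambda>z. c * f z)"
  unfolding holo_n_def
proof
  fix z assume "z \<in> \<Omega>"
  then obtain L where "(f has_derivative L) (at z)" "\<forall>c v. L (c *s v) = c * L v"
    using assms unfolding holo_n_def by blast
  then show "\<exists>L. ((\<lambda>z. c * f z) has_derivative L) (at z) \<and> (\<forall>c v. L (c *s v) = c * L v)"
    by (intro exI[of _ "\<lambda>v. c * L v"]) (auto intro: has_derivative_mult_right)
qed

lemma Ap_space_add:
  "f \<in> Ap_space \<Omega> wt p \<Longrightarrow> g \<in> Ap_space \<Omega> wt p \<Longrightarrow> 0 \<le> p \<Longrightarrow> (\<lambda>z. f z + g z) \<in> Ap_space \<Omega> wt p"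
  by (simp add: Ap_space_def mem_Lp_space_iff p_integrable_add holo_n_add)

lemma Ap_space_cmult: "f \<in> Ap_space \<Omega> wt p \<Longrightarrow> (\<lambda>z. c * f z) \<in> Ap_space \<Omega> wt p"
  by (simp add: Ap_space_def mem_Lp_space_iff p_integrable_cmult holo_n_cmult)

lemma Ap_space_zero: "(\<lambda>z. 0) \<in> Ap_space \<Omega> wt p"
  by (auto simp: Ap_space_def mem_Lp_space_iff holo_n_def p_integrable_zero intro!: exI[of _ "\<lambda>_. 0"])

lemma Ap_space_sum:
  assumes "\<And>i. i \<in> I \<Longrightarrow> f i \<in> Ap_space \<Omega> wt p" "0 \<le> p"
  shows "(\<lambda>z. \<Sum>i\<in>I. f i z) \<in> Ap_space \<Omega> wt p"
  using assms by (induction I rule: infinite_finite_induct) (auto intro: Ap_space_add Ap_space_zero)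

lemma Ap_space_diff:
  assumes "f \<in> Ap_space \<Omega> wt p" "g \<in> Ap_space \<Omega> wt p" "0 \<le> p"
  shows "(\<lambda>z. f z - g z) \<in> Ap_space \<Omega> wt p"
  using Ap_space_add[OF assms(1) Ap_space_cmult[OF assms(2), of "-1"] assms(3)] by simp

locale weighted_reinhardt =
  fixes \<Omega> :: "(complex^'n::finite) set" and wt :: "complex^'n \<Rightarrow> ennreal" and p :: real
  assumes open_\<Omega>: "open \<Omega>" and nonempty_\<Omega>: "\<Omega> \<noteq> {}" and reinhardt_\<Omega>: "reinhardt \<Omega>"
    and p_gt_1: "1 < p"
    and wt_measurable: "(\<lambda>z. wt z * indicator \<Omega> z) \<in> borel_measurable lebesgue"
    and admissible_wt: "admissible \<Omega> wt p" and multi_radial_wt: "multi_radial \<Omega> wt"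
begin

abbreviation "M \<equiv> wmeasure \<Omega> wt"
abbreviation "pnorm \<equiv> p_norm p M"
abbreviation "Ap \<equiv> Ap_space \<Omega> wt p"
abbreviation "Sp \<equiv> Sp_set \<Omega> wt p"
abbreviation "trunc \<equiv> trunc_set \<Omega> wt p"

lemma p_nonneg: "0 \<le> p"
  using p_gt_1 by simp

lemma Ap_p_integrable: "f \<in> Ap \<Longrightarrow> p_integrable p M f"
  by (simp add: Ap_space_def mem_Lp_space_iff)

lemma Sp_Ap: "\<alpha> \<in> Sp \<Longrightarrow> monom \<alpha> \<in> Ap"
  by (simp add: Sp_set_def)

lemma Sp_p_integrable: "\<alpha> \<in> Sp \<Longrightarrow> p_integrable p M (monom \<alpha>)"
  by (rule Ap_p_integrable[OF Sp_Ap])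

lemma trunc_Sp: "\<alpha> \<in> trunc N \<Longrightarrow> \<alpha> \<in> Sp"
  using trunc_set_subset by blast

lemma monom_measurable [measurable]: "monom \<alpha> \<in> borel_measurable M"
  using measurable_completion[of "monom \<alpha>" lborel borel] by (simp add: wmeasure_def)

lemma AE_in_\<Omega>: "AE z in M. z \<in> \<Omega>"
  unfolding wmeasure_def using wt_measurable by (subst AE_density) (auto simp: indicator_def)

lemma Ap_bounded_on_compact:
  assumes "compact K" "K \<subseteq> \<Omega>"
  obtains C where "\<And>f z. f \<in> Ap \<Longrightarrow> z \<in> K \<Longrightarrow> norm (f z) \<le> C * pnorm f"
proof -
  obtain C where "\<forall>f\<in>Ap. \<forall>z\<in>K. norm (f z) \<le> C * Lpnorm \<Omega> wt p f"
    using admissible_wt assms unfolding admissible_def by blast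
  then show ?thesis
    by (intro that[of C]) (metis Ap_p_integrable Lpnorm_eq_p_norm)
qed

lemma Ap_bounded_at:
  assumes "z \<in> \<Omega>"
  obtains C where "\<And>f. f \<in> Ap \<Longrightarrow> norm (f z) \<le> C * pnorm f"
  by (rule Ap_bounded_on_compact[of "{z}"]) (use assms that in auto)

lemma p_norm_monom_pos:
  assumes "\<alpha> \<in> Sp"
  shows "0 < pnorm (monom \<alpha>)"
proof -
  obtain a where a: "a \<in> \<Omega>" "\<And>j. a$j \<noteq> 0"
    using open_contains_nonzero_coordinates[OF open_\<Omega> nonempty_\<Omega>] by blast
  obtain C where "norm (monom \<alpha> a) \<le> C * pnorm (monom \<alpha>)"
    using Ap_bounded_at[OF a(1)] Sp_Ap[OF assms] by blast
  moreover have "0 < norm (monom \<alpha> a)" using a(2) by (simp add: monom_def)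
  ultimately have "pnorm (monom \<alpha>) \<noteq> 0" by auto
  then show ?thesis using p_norm_nonneg[of p M "monom \<alpha>"] by simp
qed

section \<open>Laurent coefficients as integrals\<close>

definition coeff_functional :: "('n \<Rightarrow> int) \<Rightarrow> (complex^'n \<Rightarrow> complex) \<Rightarrow> complex" where
  "coeff_functional \<alpha> f = (\<integral>w. f w * duality_map p (monom \<alpha> w) \<partial>M) / of_real (pnorm (monom \<alpha>) powr p)"

lemma coeff_functional_bound:
  assumes f: "p_integrable p M f" and \<alpha>: "\<alpha> \<in> Sp"
  shows "norm (coeff_functional \<alpha> f) * pnorm (monom \<alpha>) \<le> pnorm f"
proof -
  let ?e = "pnorm (monom \<alpha>)"
  have "norm (coeff_functional \<alpha> f) * (?e * ?e powr (p - 1))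
      = norm (\<integral>w. f w * duality_map p (monom \<alpha> w) \<partial>M)"
    using p_norm_monom_pos[OF \<alpha>] by (simp add: coeff_functional_def norm_divide powr_mult_base)
  also have "\<dots> \<le> pnorm f * ?e powr (p - 1)"
    by (rule Holder_duality_map[OF p_gt_1 f Sp_p_integrable[OF \<alpha>]])
  finally have "(norm (coeff_functional \<alpha> f) * ?e) * ?e powr (p - 1) \<le> pnorm f * ?e powr (p - 1)"
    by (simp only: mult.assoc)
  then show ?thesis using p_norm_monom_pos[OF \<alpha>] by (simp add: mult_le_cancel_right)
qed

lemma coeff_functional_add:
  assumes "p_integrable p M f" "p_integrable p M g" "\<alpha> \<in> Sp"
  shows "coeff_functional \<alpha> (\<lambda>z. f z + g z) = coeff_functional \<alpha> f + coeff_functional \<alpha> g"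
  using integrable_mult_duality_map[OF p_gt_1 _ Sp_p_integrable[OF assms(3)]] assms(1,2)
  by (simp add: coeff_functional_def distrib_right add_divide_distrib)

lemma coeff_functional_cmult: "coeff_functional \<alpha> (\<lambda>z. c * f z) = c * coeff_functional \<alpha> f"
  by (simp add: coeff_functional_def mult.assoc)

lemma coeff_functional_diff:
  assumes "p_integrable p M f" "p_integrable p M g" "\<alpha> \<in> Sp"
  shows "coeff_functional \<alpha> (\<lambda>z. f z - g z) = coeff_functional \<alpha> f - coeff_functional \<alpha> g"
  using coeff_functional_add[OF assms(1) p_integrable_cmult[OF assms(2), of "-1"] assms(3)]
    coeff_functional_cmult[of \<alpha> "-1" g] by simp

lemma coeff_functional_sum:
  assumes "\<And>i. i \<in> I \<Longrightarrow> p_integrable p M (f i)" "\<alpha> \<in> Sp"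
  shows "coeff_functional \<alpha> (\<lambda>z. \<Sum>i\<in>I. f i z) = (\<Sum>i\<in>I. coeff_functional \<alpha> (f i))"
  using integrable_mult_duality_map[OF p_gt_1 assms(1) Sp_p_integrable[OF assms(2)]]
  by (simp add: coeff_functional_def sum_distrib_right sum_divide_distrib
      Bochner_Integration.integral_sum)

lemma coeff_functional_cong:
  assumes "p_integrable p M f" "p_integrable p M g" "\<And>z. z \<in> \<Omega> \<Longrightarrow> f z = g z"
  shows "coeff_functional \<alpha> f = coeff_functional \<alpha> g"
proof -
  note [measurable] = p_integrable_measurable[OF assms(1)] p_integrable_measurable[OF assms(2)]
  have "(\<integral>w. f w * duality_map p (monom \<alpha> w) \<partial>M) = (\<integral>w. g w * duality_map p (monom \<alpha> w) \<partial>M)"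
    by (rule integral_cong_AE) (use AE_in_\<Omega> assms(3) in \<open>auto elim: eventually_mono\<close>)
  then show ?thesis by (simp add: coeff_functional_def)
qed

lemma coeff_functional_monom:
  assumes "\<alpha> \<in> Sp"
  shows "coeff_functional \<alpha> (monom \<beta>) = (if \<alpha> = \<beta> then 1 else 0)"
proof (cases "\<alpha> = \<beta>")
  case True
  then show ?thesis
    using p_norm_monom_pos[OF assms] p_gt_1
    by (simp add: coeff_functional_def mult_duality_map flip: p_norm_powr)
next
  case False
  then show ?thesis
    using monom_orthogonal[OF torus_invariant_wmeasure[OF reinhardt_\<Omega> multi_radial_wt wt_measurable]]
    by (simp add: coeff_functional_def)
qed

lemma coeff_functional_laurent_polynomial:
  assumes "finite I" "I \<subseteq> Sp" "\<alpha> \<in> Sp"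
  shows "coeff_functional \<alpha> (\<lambda>z. \<Sum>\<beta>\<in>I. c \<beta> * monom \<beta> z) = (if \<alpha> \<in> I then c \<alpha> else 0)"
proof -
  have "coeff_functional \<alpha> (\<lambda>z. \<Sum>\<beta>\<in>I. c \<beta> * monom \<beta> z)
      = (\<Sum>\<beta>\<in>I. coeff_functional \<alpha> (\<lambda>z. c \<beta> * monom \<beta> z))"
    by (rule coeff_functional_sum) (use assms in \<open>auto intro!: p_integrable_cmult Sp_p_integrable\<close>)
  also have "\<dots> = (\<Sum>\<beta>\<in>I. if \<alpha> = \<beta> then c \<beta> else 0)"
    by (rule sum.cong) (auto simp: coeff_functional_cmult coeff_functional_monom assms(3))
  finally show ?thesis using assms(1) by simp
qed

section \<open>Local summability of normalized monomials\<close>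

definition monom_ratio :: "('n \<Rightarrow> int) \<Rightarrow> complex^'n \<Rightarrow> real" where
  "monom_ratio \<alpha> z = norm (monom \<alpha> z) / pnorm (monom \<alpha>)"

lemma monom_ratio_nonneg: "0 \<le> monom_ratio \<alpha> z"
  by (simp add: monom_ratio_def p_norm_nonneg)

lemma monom_ratio_le_iff: "\<alpha> \<in> Sp \<Longrightarrow> monom_ratio \<alpha> z \<le> c \<longleftrightarrow> norm (monom \<alpha> z) \<le> c * pnorm (monom \<alpha>)"
  using p_norm_monom_pos by (simp add: monom_ratio_def pos_divide_le_eq)

lemma monom_ratio_locally_dominated:
  assumes "a \<in> \<Omega>"
  obtains h where "h summable_on Sp" "\<forall>\<^sub>F z in nhds a. \<forall>\<alpha>\<in>Sp. monom_ratio \<alpha> z \<le> h \<alpha>"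
proof -
  obtain r where r: "0 < r" "cpolydisc a r \<subseteq> \<Omega>"
    using open_contains_cpolydisc[OF open_\<Omega> assms] by blast
  obtain C where C: "\<And>f z. f \<in> Ap \<Longrightarrow> z \<in> cpolydisc a r \<Longrightarrow> norm (f z) \<le> C * pnorm f"
    using Ap_bounded_on_compact[OF compact_cpolydisc r(2)] by blast
  have exponent_nonneg: "\<forall>j. a$j = 0 \<longrightarrow> 0 \<le> \<alpha> j" if "\<alpha> \<in> Sp" for \<alpha>
    using monom_bounded_imp_exponent_nonneg[OF r(1) C[OF Sp_Ap[OF that]]] by blast
  obtain \<rho> :: "'n \<Rightarrow> real" where \<rho>: "\<And>j. 0 \<le> \<rho> j" "\<And>j. \<rho> j < 1"
    and near: "\<forall>\<^sub>F z in nhds a. \<forall>\<alpha>. (\<forall>j. a$j = 0 \<longrightarrow> 0 \<le> \<alpha> j) \<longrightarrow>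
       (\<exists>t\<in>cpolydisc a r. norm (monom \<alpha> z) \<le> (\<Prod>j\<in>UNIV. \<rho> j ^ nat \<bar>\<alpha> j\<bar>) * norm (monom \<alpha> t))"
    by (rule monom_locally_dominated[OF r(1), of a]) (rule that)
  define h where "h \<alpha> = (\<Prod>j\<in>UNIV. \<rho> j ^ nat \<bar>\<alpha> j\<bar>) * C" for \<alpha> :: "'n \<Rightarrow> int"
  have "(\<lambda>\<alpha>::'n \<Rightarrow> int. \<Prod>j\<in>UNIV. \<rho> j ^ nat \<bar>\<alpha> j\<bar>) summable_on Sp"
    by (rule summable_on_subset_banach[OF summable_on_prod_geometric_int[of \<rho>, OF \<rho>]]) simp
  then have "h summable_on Sp"
    unfolding h_def by (rule summable_on_cmult_left)
  moreover have "\<forall>\<^sub>F z in nhds a. \<forall>\<alpha>\<in>Sp. monom_ratio \<alpha> z \<le> h \<alpha>"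
    using near
  proof eventually_elim
    case (elim z)
    show ?case
    proof
      fix \<alpha> assume \<alpha>: "\<alpha> \<in> Sp"
      then obtain t where t: "t \<in> cpolydisc a r"
        "norm (monom \<alpha> z) \<le> (\<Prod>j\<in>UNIV. \<rho> j ^ nat \<bar>\<alpha> j\<bar>) * norm (monom \<alpha> t)"
        using spec[OF elim, of \<alpha>] exponent_nonneg[OF \<alpha>] by blast
      note t(2)
      also have "(\<Prod>j\<in>UNIV. \<rho> j ^ nat \<bar>\<alpha> j\<bar>) * norm (monom \<alpha> t)
          \<le> (\<Prod>j\<in>UNIV. \<rho> j ^ nat \<bar>\<alpha> j\<bar>) * (C * pnorm (monom \<alpha>))"
        using t(1) \<rho>(1) by (intro mult_left_mono C Sp_Ap \<alpha> prod_nonneg) auto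
      finally show "monom_ratio \<alpha> z \<le> h \<alpha>"
        by (simp add: monom_ratio_le_iff[OF \<alpha>] h_def mult.assoc)
    qed
  qed
  ultimately show ?thesis by (rule that)
qed

lemma monom_ratio_summable_majorant:
  assumes "compact K" "K \<subseteq> \<Omega>"
  obtains h where "h summable_on Sp" "\<And>\<alpha> z. \<alpha> \<in> Sp \<Longrightarrow> z \<in> K \<Longrightarrow> monom_ratio \<alpha> z \<le> h \<alpha>"
proof (rule compact_locally_summable_majorant[OF assms(1) monom_ratio_nonneg])
  fix a assume "a \<in> K"
  then show "\<exists>h. h summable_on Sp \<and> (\<forall>\<^sub>F z in nhds a. \<forall>\<alpha>\<in>Sp. monom_ratio \<alpha> z \<le> h \<alpha>)"
    using monom_ratio_locally_dominated assms(2) by blast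
qed (rule that)

lemma monom_ratio_summable:
  assumes "z \<in> \<Omega>"
  shows "(\<lambda>\<alpha>. monom_ratio \<alpha> z) summable_on Sp"
proof -
  obtain h where "h summable_on Sp" "\<And>\<alpha>. \<alpha> \<in> Sp \<Longrightarrow> monom_ratio \<alpha> z \<le> h \<alpha>"
    by (rule monom_ratio_summable_majorant[of "{z}"]) (use assms in auto)
  then show ?thesis
    by (rule summable_on_comparison_test) (simp_all add: monom_ratio_nonneg)
qed

lemma coeff_functional_monom_le_ratio:
  assumes "p_integrable p M f" "\<alpha> \<in> Sp"
  shows "norm (coeff_functional \<alpha> f * monom \<alpha> z) \<le> pnorm f * monom_ratio \<alpha> z"
  using mult_right_mono[OF coeff_functional_bound[OF assms], of "norm (monom \<alpha> z) / pnorm (monom \<alpha>)"]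
    p_norm_monom_pos[OF assms(2)]
  by (simp add: norm_mult monom_ratio_def)

section \<open>The monomial basis kernel\<close>

abbreviation "conj_exp \<equiv> p / (p - 1)"

definition kernel_term :: "complex^'n \<Rightarrow> ('n \<Rightarrow> int) \<Rightarrow> complex^'n \<Rightarrow> complex" where
  "kernel_term z \<alpha> w = monom \<alpha> z * duality_map p (monom \<alpha> w) / of_real (pnorm (monom \<alpha>) powr p)"

lemma kernel_term_measurable [measurable]: "kernel_term z \<alpha> \<in> borel_measurable M"
  unfolding kernel_term_def by measurable

lemma mb_kernel_eq_lim: "mb_kernel \<Omega> wt p z w = lim (\<lambda>N. \<Sum>\<alpha>\<in>trunc N. kernel_term z \<alpha> w)"
proof -
  have "Lpnorm \<Omega> wt p (monom \<alpha>) = pnorm (monom \<alpha>)" if "\<alpha> \<in> trunc N" for \<alpha> N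
    using that by (intro Lpnorm_eq_p_norm Sp_p_integrable trunc_Sp)
  then show ?thesis
    by (simp add: mb_kernel_def kernel_term_def duality_map_def mult.assoc cong: sum.cong)
qed

lemma mb_kernel_measurable [measurable]: "mb_kernel \<Omega> wt p z \<in> borel_measurable M"
  unfolding mb_kernel_eq_lim[abs_def] by measurable

lemma kernel_term_eq_cmult:
  "kernel_term z \<alpha> = (\<lambda>w. monom \<alpha> z / of_real (pnorm (monom \<alpha>) powr p) * duality_map p (monom \<alpha> w))"
  by (simp add: kernel_term_def fun_eq_iff)

lemma norm_kernel_term: "norm (kernel_term z \<alpha> w) = monom_ratio \<alpha> z * monom_ratio \<alpha> w powr (p - 1)"
proof -
  have "pnorm (monom \<alpha>) powr p = pnorm (monom \<alpha>) * pnorm (monom \<alpha>) powr (p - 1)"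
    by (simp add: powr_mult_base p_norm_nonneg)
  then show ?thesis
    by (simp add: kernel_term_def monom_ratio_def norm_divide norm_mult norm_duality_map powr_divide
        p_norm_nonneg)
qed

lemma
  assumes \<alpha>: "\<alpha> \<in> Sp"
  shows p_integrable_kernel_term: "p_integrable conj_exp M (kernel_term z \<alpha>)"
    and p_norm_kernel_term: "p_norm conj_exp M (kernel_term z \<alpha>) = monom_ratio \<alpha> z"
proof -
  let ?c = "monom \<alpha> z / of_real (pnorm (monom \<alpha>) powr p)"
  show "p_integrable conj_exp M (kernel_term z \<alpha>)"
    unfolding kernel_term_eq_cmult
    by (intro p_integrable_cmult p_integrable_duality_map p_gt_1 Sp_p_integrable \<alpha>)
  have "p_norm conj_exp M (kernel_term z \<alpha>) = norm ?c * pnorm (monom \<alpha>) powr (p - 1)"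
    unfolding kernel_term_eq_cmult p_norm_duality_map[OF p_gt_1 Sp_p_integrable[OF \<alpha>], symmetric]
    using p_gt_1 by (intro p_norm_cmult) simp
  then show "p_norm conj_exp M (kernel_term z \<alpha>) = monom_ratio \<alpha> z"
    using p_norm_monom_pos[OF \<alpha>] by (simp add: monom_ratio_def norm_divide powr_diff)
qed

lemma
  assumes "p_integrable p M f" "\<alpha> \<in> Sp"
  shows integrable_kernel_term_mult: "integrable M (\<lambda>w. kernel_term z \<alpha> w * f w)"
    and integral_kernel_term_mult: "(\<integral>w. kernel_term z \<alpha> w * f w \<partial>M) = coeff_functional \<alpha> f * monom \<alpha> z"
proof -
  have pairing: "kernel_term z \<alpha> w * f w
      = monom \<alpha> z / of_real (pnorm (monom \<alpha>) powr p) * (f w * duality_map p (monom \<alpha> w))" for w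
    by (simp add: kernel_term_def)
  show "integrable M (\<lambda>w. kernel_term z \<alpha> w * f w)"
    unfolding pairing
    by (intro integrable_mult_right integrable_mult_duality_map p_gt_1 assms Sp_p_integrable)
  show "(\<integral>w. kernel_term z \<alpha> w * f w \<partial>M) = coeff_functional \<alpha> f * monom \<alpha> z"
    unfolding pairing integral_mult_right_zero by (simp add: coeff_functional_def)
qed

lemma kernel_term_abs_summable:
  assumes "z \<in> \<Omega>" "w \<in> \<Omega>"
  shows "(\<lambda>\<alpha>. norm (kernel_term z \<alpha> w)) summable_on Sp"
proof -
  obtain C where C: "\<And>f. f \<in> Ap \<Longrightarrow> norm (f w) \<le> C * pnorm f"
    using Ap_bounded_at[OF assms(2)] by blast
  have "norm (kernel_term z \<alpha> w) \<le> monom_ratio \<alpha> z * C powr (p - 1)" if \<alpha>: "\<alpha> \<in> Sp" for \<alpha>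
    unfolding norm_kernel_term using C[OF Sp_Ap[OF \<alpha>]] p_gt_1
    by (intro mult_left_mono powr_mono2 monom_ratio_nonneg) (simp_all add: monom_ratio_le_iff[OF \<alpha>])
  with summable_on_cmult_left[OF monom_ratio_summable[OF assms(1)]] show ?thesis
    by (rule summable_on_comparison_test) auto
qed

definition kernel_majorant :: "complex^'n \<Rightarrow> complex^'n \<Rightarrow> real" where
  "kernel_majorant z w = lim (\<lambda>N. \<Sum>\<alpha>\<in>trunc N. norm (kernel_term z \<alpha> w))"

lemma kernel_majorant_measurable [measurable]: "kernel_majorant z \<in> borel_measurable M"
  unfolding kernel_majorant_def[abs_def] by measurable

lemma
  assumes "z \<in> \<Omega>" "w \<in> \<Omega>"
  shows kernel_majorant_limit: "(\<lambda>N. \<Sum>\<alpha>\<in>trunc N. norm (kernel_term z \<alpha> w)) \<longlonglongrightarrow> kernel_majorant z w"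
    and mb_kernel_limit: "(\<lambda>N. \<Sum>\<alpha>\<in>trunc N. kernel_term z \<alpha> w) \<longlonglongrightarrow> mb_kernel \<Omega> wt p z w"
proof -
  note abs = kernel_term_abs_summable[OF assms]
  show "(\<lambda>N. \<Sum>\<alpha>\<in>trunc N. norm (kernel_term z \<alpha> w)) \<longlonglongrightarrow> kernel_majorant z w"
    unfolding kernel_majorant_def
    using has_sum_imp_tendsto_trunc_set[OF has_sum_infsum[OF abs]] by (metis limI)
  show "(\<lambda>N. \<Sum>\<alpha>\<in>trunc N. kernel_term z \<alpha> w) \<longlonglongrightarrow> mb_kernel \<Omega> wt p z w"
    unfolding mb_kernel_eq_lim
    using has_sum_imp_tendsto_trunc_set[OF has_sum_infsum[OF abs_summable_summable[OF abs]]]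
    by (metis limI)
qed

lemma norm_kernel_partial_sum_le:
  assumes "z \<in> \<Omega>" "w \<in> \<Omega>"
  shows "norm (\<Sum>\<alpha>\<in>trunc N. kernel_term z \<alpha> w) \<le> kernel_majorant z w"
proof -
  have "incseq (\<lambda>N. \<Sum>\<alpha>\<in>trunc N. norm (kernel_term z \<alpha> w))"
    by (intro monoI sum_mono2 finite_trunc_set trunc_set_mono) auto
  then have "(\<Sum>\<alpha>\<in>trunc N. norm (kernel_term z \<alpha> w)) \<le> kernel_majorant z w"
    by (rule incseq_le[OF _ kernel_majorant_limit[OF assms]])
  then show ?thesis by (rule order_trans[OF norm_sum])
qed

lemma p_integrable_kernel_majorant:
  assumes z: "z \<in> \<Omega>"
  shows "p_integrable conj_exp M (kernel_majorant z)"
proof (rule p_integrable_limit)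
  fix N
  have p_integrable_norm: "p_integrable conj_exp M (\<lambda>w. norm (kernel_term z \<alpha> w))" if "\<alpha> \<in> trunc N" for \<alpha>
    using p_integrable_kernel_term[OF trunc_Sp[OF that], of z] by (simp add: p_integrable_def)
  then show "p_integrable conj_exp M (\<lambda>w. \<Sum>\<alpha>\<in>trunc N. norm (kernel_term z \<alpha> w))"
    using p_gt_1 by (intro p_integrable_sum) auto
  have "p_norm conj_exp M (\<lambda>w. \<Sum>\<alpha>\<in>trunc N. norm (kernel_term z \<alpha> w))
      \<le> (\<Sum>\<alpha>\<in>trunc N. p_norm conj_exp M (\<lambda>w. norm (kernel_term z \<alpha> w)))"
    by (rule p_norm_sum_le[OF conjugate_exponent(1)[OF p_gt_1] p_integrable_norm])
  also have "\<dots> = (\<Sum>\<alpha>\<in>trunc N. monom_ratio \<alpha> z)"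
    using p_norm_kernel_term[OF trunc_Sp, of _ N z] by (simp add: p_norm_def)
  also have "\<dots> \<le> infsum (\<lambda>\<alpha>. monom_ratio \<alpha> z) Sp"
    by (rule finite_sum_le_infsum[OF monom_ratio_summable[OF z] finite_trunc_set trunc_set_subset])
      (rule monom_ratio_nonneg)
  finally show "p_norm conj_exp M (\<lambda>w. \<Sum>\<alpha>\<in>trunc N. norm (kernel_term z \<alpha> w))
      \<le> infsum (\<lambda>\<alpha>. monom_ratio \<alpha> z) Sp" .
next
  show "AE w in M. (\<lambda>N. \<Sum>\<alpha>\<in>trunc N. norm (kernel_term z \<alpha> w)) \<longlonglongrightarrow> kernel_majorant z w"
    using AE_in_\<Omega> by eventually_elim (rule kernel_majorant_limit[OF z])
qed (use p_gt_1 in auto)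

lemma p_integrable_mb_kernel:
  assumes z: "z \<in> \<Omega>"
  shows "p_integrable conj_exp M (mb_kernel \<Omega> wt p z)"
proof (rule p_integrable_bound[OF p_integrable_kernel_majorant[OF z]])
  show "AE w in M. norm (mb_kernel \<Omega> wt p z w) \<le> norm (kernel_majorant z w)"
    using AE_in_\<Omega>
  proof eventually_elim
    case (elim w)
    have "norm (mb_kernel \<Omega> wt p z w) \<le> kernel_majorant z w"
      using tendsto_norm[OF mb_kernel_limit[OF z elim]]
      by (rule LIMSEQ_le_const2) (use norm_kernel_partial_sum_le[OF z elim] in auto)
    then show ?case by simp
  qed
qed (use p_gt_1 in auto)

lemma tendsto_integral_mb_kernel:
  assumes f: "p_integrable p M f" and z: "z \<in> \<Omega>"
  shows "(\<lambda>N. \<Sum>\<alpha>\<in>trunc N. coeff_functional \<alpha> f * monom \<alpha> z) \<longlonglongrightarrow> (\<integral>w. mb_kernel \<Omega> wt p z w * f w \<partial>M)"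
proof -
  note [measurable] = p_integrable_measurable[OF f]
  have "(\<lambda>N. \<integral>w. (\<Sum>\<alpha>\<in>trunc N. kernel_term z \<alpha> w) * f w \<partial>M) \<longlonglongrightarrow> (\<integral>w. mb_kernel \<Omega> wt p z w * f w \<partial>M)"
  proof (rule integral_dominated_convergence)
    have "p_integrable p M (\<lambda>w. norm (f w))"
      using f by (simp add: p_integrable_def)
    with p_integrable_kernel_majorant[OF z]
    show "integrable M (\<lambda>w. norm (f w) * kernel_majorant z w)"
      by (intro integrable_mult_p_integrable[OF p_gt_1 conjugate_exponent[OF p_gt_1]])
    show "AE w in M. (\<lambda>N. (\<Sum>\<alpha>\<in>trunc N. kernel_term z \<alpha> w) * f w) \<longlonglongrightarrow> mb_kernel \<Omega> wt p z w * f w"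
      using AE_in_\<Omega> by eventually_elim (intro tendsto_mult mb_kernel_limit[OF z] tendsto_const)
    show "AE w in M. norm ((\<Sum>\<alpha>\<in>trunc N. kernel_term z \<alpha> w) * f w)
        \<le> norm (f w) * kernel_majorant z w" for N
      using AE_in_\<Omega>
    proof eventually_elim
      case (elim w)
      show ?case
        unfolding norm_mult mult.commute[of _ "norm (f w)"]
        by (rule mult_left_mono[OF norm_kernel_partial_sum_le[OF z elim] norm_ge_zero])
    qed
  qed measurable
  moreover have "(\<integral>w. (\<Sum>\<alpha>\<in>trunc N. kernel_term z \<alpha> w) * f w \<partial>M)
      = (\<Sum>\<alpha>\<in>trunc N. coeff_functional \<alpha> f * monom \<alpha> z)" for N
    using integrable_kernel_term_mult[OF f trunc_Sp] integral_kernel_term_mult[OF f trunc_Sp]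
    by (simp add: sum_distrib_right Bochner_Integration.integral_sum)
  ultimately show ?thesis by simp
qed

end

section \<open>The monomial basis projection\<close>

locale monomial_basis_projection = weighted_reinhardt \<Omega> wt p
  for \<Omega> :: "(complex^'n::finite) set" and wt and p +
  fixes P :: "(complex^'n \<Rightarrow> complex) \<Rightarrow> (complex^'n \<Rightarrow> complex)"
  assumes MBP: "is_MBP \<Omega> wt p P"
begin

definition P_partial_sum :: "nat \<Rightarrow> (complex^'n \<Rightarrow> complex) \<Rightarrow> complex^'n \<Rightarrow> complex" where
  "P_partial_sum N f z = (\<Sum>\<alpha>\<in>trunc N. ext_coeff \<Omega> wt p \<alpha> f * monom \<alpha> z)"

lemma P_Ap: "p_integrable p M f \<Longrightarrow> P f \<in> Ap"
  using MBP by (simp add: is_MBP_def mem_Lp_space_iff)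

lemma P_reproduces: "g \<in> Ap \<Longrightarrow> z \<in> \<Omega> \<Longrightarrow> P g z = g z"
  using MBP by (simp add: is_MBP_def)

lemma P_partial_sum_Ap: "P_partial_sum N f \<in> Ap"
  unfolding P_partial_sum_def[abs_def]
  by (intro Ap_space_sum Ap_space_cmult Sp_Ap p_nonneg) (rule trunc_Sp)

lemma P_remainder_Ap: "p_integrable p M f \<Longrightarrow> (\<lambda>z. P f z - P_partial_sum N f z) \<in> Ap"
  by (intro Ap_space_diff P_Ap P_partial_sum_Ap p_nonneg)

lemma P_remainder_tendsto_0:
  assumes "p_integrable p M f"
  shows "(\<lambda>N. pnorm (\<lambda>z. P f z - P_partial_sum N f z)) \<longlonglongrightarrow> 0"
proof -
  have "(\<lambda>N. Lpnorm \<Omega> wt p (\<lambda>z. P f z - P_partial_sum N f z)) \<longlonglongrightarrow> 0"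
    using MBP assms by (simp add: is_MBP_def mem_Lp_space_iff P_partial_sum_def)
  then show ?thesis
    by (simp add: Lpnorm_eq_p_norm[OF Ap_p_integrable[OF P_remainder_Ap[OF assms]]])
qed

lemma P_partial_sum_pointwise:
  assumes f: "p_integrable p M f" and z: "z \<in> \<Omega>"
  shows "(\<lambda>N. P_partial_sum N f z) \<longlonglongrightarrow> P f z"
proof -
  obtain C where C: "\<And>g. g \<in> Ap \<Longrightarrow> norm (g z) \<le> C * pnorm g"
    using Ap_bounded_at[OF z] by blast
  have "(\<lambda>N. P f z - P_partial_sum N f z) \<longlonglongrightarrow> 0"
    by (rule Lim_null_comparison[OF _ tendsto_mult_right_zero[OF P_remainder_tendsto_0[OF f], of C]])
      (use C[OF P_remainder_Ap[OF f]] in auto)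
  then have "(\<lambda>N. P f z - (P f z - P_partial_sum N f z)) \<longlonglongrightarrow> P f z - 0"
    by (intro tendsto_diff tendsto_const)
  then show ?thesis by simp
qed

lemma ext_coeff_eq_coeff_P:
  assumes f: "p_integrable p M f" and \<alpha>: "\<alpha> \<in> Sp"
  shows "ext_coeff \<Omega> wt p \<alpha> f = coeff_functional \<alpha> (P f)"
proof -
  let ?remainder = "\<lambda>N z. P f z - P_partial_sum N f z"
  have "(\<lambda>N. pnorm (?remainder N) / pnorm (monom \<alpha>)) \<longlonglongrightarrow> 0"
    by (rule tendsto_divide_zero[OF P_remainder_tendsto_0[OF f]])
  then have "(\<lambda>N. coeff_functional \<alpha> (?remainder N)) \<longlonglongrightarrow> 0"
    by (rule Lim_null_comparison[rotated])
      (use coeff_functional_bound[OF Ap_p_integrable[OF P_remainder_Ap[OF f]] \<alpha>] p_norm_monom_pos[OF \<alpha>]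
        in \<open>simp add: pos_le_divide_eq\<close>)
  moreover have "\<forall>\<^sub>F N in sequentially.
      coeff_functional \<alpha> (?remainder N) = coeff_functional \<alpha> (P f) - ext_coeff \<Omega> wt p \<alpha> f"
    using eventually_in_trunc_set[OF \<alpha>]
  proof eventually_elim
    case (elim N)
    have "coeff_functional \<alpha> (P_partial_sum N f) = ext_coeff \<Omega> wt p \<alpha> f"
      unfolding P_partial_sum_def[abs_def]
      using coeff_functional_laurent_polynomial[OF finite_trunc_set trunc_set_subset \<alpha>] elim by simp
    then show ?case
      using coeff_functional_diff[OF Ap_p_integrable[OF P_Ap[OF f]]
          Ap_p_integrable[OF P_partial_sum_Ap] \<alpha>] by simp
  qed
  ultimately have "(\<lambda>N. coeff_functional \<alpha> (P f) - ext_coeff \<Omega> wt p \<alpha> f) \<longlonglongrightarrow> 0"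
    by (rule Lim_transform_eventually)
  then show ?thesis by (simp add: LIMSEQ_const_iff)
qed

lemma ext_coeff_Ap:
  assumes "g \<in> Ap" "\<alpha> \<in> Sp"
  shows "ext_coeff \<Omega> wt p \<alpha> g = coeff_functional \<alpha> g"
  unfolding ext_coeff_eq_coeff_P[OF Ap_p_integrable[OF assms(1)] assms(2)]
  using assms(1) by (intro coeff_functional_cong P_reproduces Ap_p_integrable P_Ap)

lemma has_sum_Ap:
  assumes g: "g \<in> Ap" and z: "z \<in> \<Omega>"
  shows "((\<lambda>\<alpha>. coeff_functional \<alpha> g * monom \<alpha> z) has_sum g z) Sp"
proof -
  have "(\<lambda>\<alpha>. norm (coeff_functional \<alpha> g * monom \<alpha> z)) summable_on Sp"
    by (rule summable_on_comparison_test[OF summable_on_cmult_right[OF monom_ratio_summable[OF z]]])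
      (use coeff_functional_monom_le_ratio[OF Ap_p_integrable[OF g]] in auto)
  then have sum: "((\<lambda>\<alpha>. coeff_functional \<alpha> g * monom \<alpha> z)
      has_sum (\<Sum>\<^sub>\<infinity>\<alpha>\<in>Sp. coeff_functional \<alpha> g * monom \<alpha> z)) Sp"
    by (rule has_sum_infsum[OF abs_summable_summable])
  have "P_partial_sum N g z = (\<Sum>\<alpha>\<in>trunc N. coeff_functional \<alpha> g * monom \<alpha> z)" for N
    unfolding P_partial_sum_def by (intro sum.cong refl) (simp add: ext_coeff_Ap[OF g trunc_Sp])
  then have "(\<lambda>N. P_partial_sum N g z) \<longlonglongrightarrow> (\<Sum>\<^sub>\<infinity>\<alpha>\<in>Sp. coeff_functional \<alpha> g * monom \<alpha> z)"
    using has_sum_imp_tendsto_trunc_set[OF sum] by simp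
  then have "(\<Sum>\<^sub>\<infinity>\<alpha>\<in>Sp. coeff_functional \<alpha> g * monom \<alpha> z) = P g z"
    by (rule LIMSEQ_unique[OF _ P_partial_sum_pointwise[OF Ap_p_integrable[OF g] z]])
  with sum show ?thesis by (simp add: P_reproduces[OF g z])
qed

lemma Ap_laurent_series:
  assumes g: "g \<in> Ap"
  shows "laurent_series \<Omega> g (\<lambda>\<alpha>. if \<alpha> \<in> Sp then coeff_functional \<alpha> g else 0)"
    (is "laurent_series \<Omega> g ?c")
  unfolding laurent_series_def
proof (intro conjI ballI allI impI)
  fix z assume "z \<in> \<Omega>"
  show "((\<lambda>\<alpha>. ?c \<alpha> * monom \<alpha> z) has_sum g z) UNIV"
    using has_sum_Ap[OF g \<open>z \<in> \<Omega>\<close>] by (rule has_sum_cong_neutral[THEN iffD1, rotated -1]) auto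
next
  fix K assume K: "compact K \<and> K \<subseteq> \<Omega> \<and> K \<noteq> {}"
  then obtain h where h: "h summable_on Sp" "\<And>\<alpha> z. \<alpha> \<in> Sp \<Longrightarrow> z \<in> K \<Longrightarrow> monom_ratio \<alpha> z \<le> h \<alpha>"
    using monom_ratio_summable_majorant by metis
  have bound: "norm (coeff_functional \<alpha> g * monom \<alpha> z) \<le> pnorm g * h \<alpha>"
    if "\<alpha> \<in> Sp" "z \<in> K" for \<alpha> z
    using coeff_functional_monom_le_ratio[OF Ap_p_integrable[OF g] that(1)]
    by (rule order_trans) (intro mult_left_mono h(2) that p_norm_nonneg)
  have "(\<lambda>\<alpha>. SUP z\<in>K. norm (coeff_functional \<alpha> g * monom \<alpha> z)) summable_on Sp"
  proof (rule summable_on_comparison_test[OF summable_on_cmult_right[OF h(1), of "pnorm g"]])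
    fix \<alpha> assume "\<alpha> \<in> Sp"
    show "(SUP z\<in>K. norm (coeff_functional \<alpha> g * monom \<alpha> z)) \<le> pnorm g * h \<alpha>"
      using K bound[OF \<open>\<alpha> \<in> Sp\<close>] by (intro cSUP_least) auto
    obtain a where "a \<in> K" using K by blast
    have "norm (coeff_functional \<alpha> g * monom \<alpha> a)
        \<le> (SUP z\<in>K. norm (coeff_functional \<alpha> g * monom \<alpha> z))"
      using \<open>a \<in> K\<close> bound[OF \<open>\<alpha> \<in> Sp\<close>] by (intro cSUP_upper bdd_aboveI2)
    then show "0 \<le> (SUP z\<in>K. norm (coeff_functional \<alpha> g * monom \<alpha> z))"
      by (rule order_trans[OF norm_ge_zero])
  qed
  then show "(\<lambda>\<alpha>. SUP z\<in>K. norm (?c \<alpha> * monom \<alpha> z)) summable_on UNIV"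
    using K by (subst (asm) summable_on_cong_neutral[of UNIV Sp]) (auto simp: cSUP_const)
qed

lemma laurent_coeff_Ap:
  assumes "g \<in> Ap" "\<alpha> \<in> Sp"
  shows "laurent_coeff \<Omega> \<alpha> g = coeff_functional \<alpha> g"
proof -
  have "(THE c. laurent_series \<Omega> g c) = (\<lambda>\<alpha>. if \<alpha> \<in> Sp then coeff_functional \<alpha> g else 0)"
    using Ap_laurent_series[OF assms(1)] laurent_series_unique[OF open_\<Omega> nonempty_\<Omega> reinhardt_\<Omega>]
    by (intro the_equality)
  then show ?thesis using assms(2) by (simp add: laurent_coeff_def)
qed

lemma coeff_opnorm_eq:
  assumes \<alpha>: "\<alpha> \<in> Sp"
  shows "coeff_opnorm \<Omega> wt p \<alpha> = 1 / pnorm (monom \<alpha>)"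
proof -
  have "coeff_opnorm \<Omega> wt p \<alpha>
      = Sup ({norm (coeff_functional \<alpha> f) / pnorm f | f. f \<in> Ap \<and> 0 < pnorm f} \<union> {0})"
    unfolding coeff_opnorm_def
    by (intro arg_cong[of _ _ Sup] arg_cong2[of _ _ _ _ "(\<union>)"] Collect_cong refl)
      (metis Ap_p_integrable Lpnorm_eq_p_norm laurent_coeff_Ap \<alpha>)
  also have "\<dots> = 1 / pnorm (monom \<alpha>)"
  proof (rule cSup_eq_maximum)
    show "1 / pnorm (monom \<alpha>)
        \<in> {norm (coeff_functional \<alpha> f) / pnorm f | f. f \<in> Ap \<and> 0 < pnorm f} \<union> {0}"
      using Sp_Ap[OF \<alpha>] p_norm_monom_pos[OF \<alpha>] coeff_functional_monom[OF \<alpha>, of \<alpha>]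
      by (intro UnI1 CollectI exI[of _ "monom \<alpha>"]) simp
    fix x assume "x \<in> {norm (coeff_functional \<alpha> f) / pnorm f | f. f \<in> Ap \<and> 0 < pnorm f} \<union> {0}"
    then consider (quotient) f where "x = norm (coeff_functional \<alpha> f) / pnorm f" "f \<in> Ap" "0 < pnorm f"
      | (zero) "x = 0"
      by blast
    then show "x \<le> 1 / pnorm (monom \<alpha>)"
    proof cases
      case (quotient f)
      then show ?thesis
        using coeff_functional_bound[OF Ap_p_integrable \<alpha>] p_norm_monom_pos[OF \<alpha>]
        by (simp add: pos_le_divide_eq pos_divide_le_eq)
    qed (simp add: p_norm_nonneg)
  qed
  finally show ?thesis .
qed

lemma ext_coeff_eq:
  assumes \<alpha>: "\<alpha> \<in> Sp" and f: "p_integrable p M f"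
  shows "ext_coeff \<Omega> wt p \<alpha> f = coeff_functional \<alpha> f"
proof -
  have "ext_coeff \<Omega> wt p \<alpha> = (\<lambda>f. if p_integrable p M f then coeff_functional \<alpha> f else 0)"
    unfolding ext_coeff_def coeff_opnorm_eq[OF \<alpha>]
  proof (rule the_equality, goal_cases extension unique)
    case extension
    show ?case
      using coeff_functional_bound[OF _ \<alpha>] p_norm_monom_pos[OF \<alpha>]
      by (auto simp: mem_Lp_space_iff Ap_p_integrable laurent_coeff_Ap \<alpha> p_integrable_add
          p_integrable_cmult p_nonneg coeff_functional_add coeff_functional_cmult Lpnorm_eq_p_norm
          pos_le_divide_eq)
  next
    case (unique \<Phi>)
    interpret norming_functional p M "monom \<alpha>" \<Phi>
    proof
      show "\<Phi> (monom \<alpha>) = 1"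
        using unique Sp_Ap[OF \<alpha>] laurent_coeff_Ap[OF Sp_Ap[OF \<alpha>] \<alpha>] coeff_functional_monom[OF \<alpha>]
        by simp
      show "norm (\<Phi> f) * pnorm (monom \<alpha>) \<le> pnorm f" if "p_integrable p M f" for f
        using unique that p_norm_monom_pos[OF \<alpha>]
        by (simp add: mem_Lp_space_iff Lpnorm_eq_p_norm pos_le_divide_eq)
    qed (use unique p_gt_1 Sp_p_integrable[OF \<alpha>] p_norm_monom_pos[OF \<alpha>]
        in \<open>auto simp: mem_Lp_space_iff\<close>)
    have "\<Phi> g = coeff_functional \<alpha> g" if "p_integrable p M g" for g
      using eq_normalized_pairing[OF that] by (simp add: coeff_functional_def)
    then show ?case using unique by (auto simp: mem_Lp_space_iff)
  qed
  then show ?thesis using f by simp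
qed

lemma P_eq_kernel_integral:
  assumes f: "p_integrable p M f" and z: "z \<in> \<Omega>"
  shows "P f z = (\<integral>w. mb_kernel \<Omega> wt p z w * f w \<partial>M)"
proof -
  have "P_partial_sum N f z = (\<Sum>\<alpha>\<in>trunc N. coeff_functional \<alpha> f * monom \<alpha> z)" for N
    unfolding P_partial_sum_def by (intro sum.cong refl) (simp add: ext_coeff_eq[OF trunc_Sp f])
  then have "(\<lambda>N. P_partial_sum N f z) \<longlonglongrightarrow> (\<integral>w. mb_kernel \<Omega> wt p z w * f w \<partial>M)"
    using tendsto_integral_mb_kernel[OF f z] by simp
  then show ?thesis
    by (rule LIMSEQ_unique[OF P_partial_sum_pointwise[OF f z]])
qed

end

theorem theorem3p5:
  fixes \<Omega> :: "(complex^'n::finite) set"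
    and wt :: "complex^'n \<Rightarrow> ennreal"
    and p :: real
    and P :: "(complex^'n \<Rightarrow> complex) \<Rightarrow> (complex^'n \<Rightarrow> complex)"
  assumes "cdomain \<Omega>" and "bounded \<Omega>" and "pseudoconvex \<Omega>" and "reinhardt \<Omega>"
    and "1 < p"
    and "(\<lambda>z. wt z * indicator \<Omega> z) \<in> borel_measurable lebesgue"
    and "AE z in lebesgue. z \<in> \<Omega> \<longrightarrow> wt z > 0"
    and "admissible \<Omega> wt p" and "multi_radial \<Omega> wt"
    and "is_MBP \<Omega> wt p P"
  shows "(\<forall>f\<in>Lp_space \<Omega> wt p. \<forall>z\<in>\<Omega>.
            P f z = (\<integral>w. mb_kernel \<Omega> wt p z w * f w \<partial>wmeasure \<Omega> wt))
       \<and> (\<forall>z\<in>\<Omega>. mb_kernel \<Omega> wt p z \<in> Lp_space \<Omega> wt (p / (p - 1)))"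
proof -
  interpret monomial_basis_projection \<Omega> wt p P
    by unfold_locales (use assms in \<open>auto simp: cdomain_def\<close>)
  show ?thesis
    using P_eq_kernel_integral p_integrable_mb_kernel by (simp add: mem_Lp_space_iff)
qed

end
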